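(* Let $k \geq 2$ be an integer. Let $K \subset \mathbb{R}^2$ be a plane convex body, and let $\mathcal{F} = \{ F_i : i \in I\}$ be a family of pairwise disjoint open topological discs in $\mathbb{R}^2$ such that, for every $i \in I$, if $F_i \cap \partial K \neq\emptyset$ then $F_i \cap \partial K$ is a connected curve and $F_i$ is convex. Let $X = K \setminus \left( \bigcup_{i\in I} F_i \right)$. Then $$\operatorname{area}\left( \frac{1}{k} X[k] \right) \leq \operatorname{area}\left( \frac{1}{k+1} X[k+1] \right).$$
   Context: For $A \subset \mathbb{R}^2$ and an integer $m\ge 1$, $A[m] = \{a_1+\cdots+a_m : a_1,\ldots,a_m \in A\}$ is the Minkowski sum of $m$ copies of $A$, and $tA=\{ta: a\in A\}$ for $t\in\mathbb{R}$. $\operatorname{area}$ denotes two-dimensional Lebesgue measure and $\partial K$ is the topological boundary of $K$. A convex body is a compact convex set with nonempty interior. An open topological disc is the bounded connected component of the complement in $\mathbb{R}^2$ of a Jordan curve (simple closed continuous curve). *)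

theory Defs
  imports "HOL-Analysis.Analysis"
begin

definition minkowski_multiple :: "'a::comm_monoid_add set \<Rightarrow> nat \<Rightarrow> 'a set" where
  "minkowski_multiple A m = {\<Sum>j<m. a j | a. \<forall>j<m. a j \<in> A}"

definition convex_body :: "'a::euclidean_space set \<Rightarrow> bool" where
  "convex_body K \<longleftrightarrow> compact K \<and> convex K \<and> interior K \<noteq> {}"

definition jordan_curve :: "(real^2) set \<Rightarrow> bool" where
  "jordan_curve C \<longleftrightarrow> (\<exists>g. simple_path g \<and> pathfinish g = pathstart g \<and> C = path_image g)"

(* By the Jordan curve theorem, the bounded component of - C is unique. *)
definition open_topological_disc :: "(real^2) set \<Rightarrow> bool" where
  "open_topological_disc D \<longleftrightarrow> (\<exists>C. jordan_curve C \<and> D \<in> components (- C) \<and> bounded D)"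

end

theory Submission
  imports Defs
begin

text \<open>Let \<open>W\<close> be the convex hull of \<open>X\<close>; all the sets \<open>X[m] / m\<close> lie in \<open>W\<close>, so it suffices that the
  area of the part of \<open>W\<close> they miss decreases. Comparing a disc with a reflected, shrunken copy
  of itself shows that every point of a disc is a mean of \<open>m \<ge> 2\<close> points of its boundary, so
  discs inside \<open>K\<close> are never missed. A disc \<open>F\<close> that meets \<open>\<partial>K\<close> is convex and leaves \<open>W\<close> through a
  single chord with end points \<open>p, q \<in> X\<close>, and the rest of the boundary of \<open>T = F \<inter> W\<close> lies in \<open>X\<close>.
  The sum of two points of \<open>T\<close> is a sum of two points of this curve unless it lies in \<open>p + T\<close> or
  \<open>q + T\<close>. Hence a point of \<open>T\<close> missed by \<open>X[m] / m\<close> lies in one of the \<open>m\<close> copies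
  \<open>(T + (m - 1 - j) p + j q) / m\<close>. The homotheties of ratio \<open>m / (m + 1)\<close> centred at \<open>p\<close> and \<open>q\<close>
  compare the missed area in the \<open>j\<close>-th of \<open>m + 1\<close> copies with that in the \<open>j\<close>-th and in the
  \<open>(j - 1)\<close>-th of \<open>m\<close> copies; averaging these two bounds with weights \<open>1 - j / m\<close> and \<open>j / m\<close>
  gives the decrease.\<close>

subsection \<open>Discs are covered by means of boundary points\<close>

text \<open>By the Jordan-Brouwer theorem the frontier of a bounded component is the whole curve,
  hence connected. Only these five properties of a disc are used afterwards.\<close>

lemma open_topological_disc_properties:
  assumes "open_topological_disc D"
  shows "open D" "bounded D" "connected D" "D \<noteq> {}" "connected (frontier D)"
proof -
  obtain g where g: "simple_path g" "pathfinish g = pathstart g"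
    and D: "D \<in> components (- path_image g)" "bounded D"
    using assms unfolding open_topological_disc_def jordan_curve_def by blast
  have cl: "closed (path_image g)"
    using g(1) by (simp add: closed_simple_path_image)
  show "open D" using D cl open_components by blast
  show "bounded D" "connected D" "D \<noteq> {}"
    using D in_components_connected in_components_nonempty by auto
  have "path_image g homeomorphic sphere (0::complex) 1"
    using homeomorphic_simple_path_image_circle [OF g] by simp
  also have "sphere (0::complex) 1 homeomorphic sphere (0::real^2) 1"
    by (rule homeomorphic_spheres_gen) auto
  finally have "frontier D = path_image g"
    using Jordan_Brouwer_frontier [of "path_image g" "0::real^2" 1 D] D by simp
  then show "connected (frontier D)"
    using g(1) connected_simple_path_image by auto
qed

text \<open>Since \<open>frontier E\<close> misses \<open>D\<close>, the connected set
  \<open>D\<close> lies inside \<open>E\<close>. The area comparison makes the open set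
  \<open>E - closure D\<close> null, hence empty, so \<open>E\<close> is squeezed between
  \<open>D\<close> and \<open>closure D\<close>. If the frontiers were disjoint, \<open>E\<close>
  would then have no frontier at all.\<close>

lemma frontiers_meet_if_frontier_disjoint:
  fixes D E :: "'a::euclidean_space set"
  assumes "open D" "bounded D" "connected D" "open E" "bounded E"
    and "D \<inter> E \<noteq> {}" "measure lebesgue E \<le> measure lebesgue D"
    and "frontier E \<inter> D = {}"
  shows "frontier D \<inter> frontier E \<noteq> {}"
proof
  assume disj: "frontier D \<inter> frontier E = {}"
  have lm: "D \<in> lmeasurable" "E \<in> lmeasurable"
    using assms lmeasurable_open by auto
  have "D \<subseteq> E"
    using connected_Int_frontier [of D E] assms by blast
  then have "measure lebesgue (E - D) \<le> 0"
    using measurable_measure_Diff [OF lm(2), of D] lm(1) assms(7) by (simp add: fmeasurableD)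
  moreover have "E - closure D \<in> lmeasurable" "E - D \<in> lmeasurable"
    using assms lm by (simp_all add: lmeasurable_open bounded_diff fmeasurable.Diff open_Diff)
  ultimately have "measure lebesgue (E - closure D) \<le> 0"
    using measure_mono_fmeasurable [of "E - closure D" "E - D" lebesgue] closure_subset [of D]
    by (force simp: fmeasurableD)
  then have "negligible (E - closure D)"
    using \<open>E - closure D \<in> lmeasurable\<close>
    by (metis measure_le_0_iff negligible_iff_measure)
  then have sub: "E \<subseteq> closure D"
    using open_not_negligible [of "E - closure D"] assms(4) by (metis Diff_eq_empty_iff closed_closure open_Diff)
  have "frontier E \<subseteq> closure D"
    using closure_mono [OF sub] by (auto simp: frontier_def)
  then have "frontier E \<subseteq> D"
    using disj closure_Un_frontier by blast
  then have "frontier E = {}" using assms(8) by blast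
  then have "E = {} \<or> E = UNIV" by (simp add: frontier_eq_empty)
  then show False
    using assms not_bounded_UNIV by auto
qed

text \<open>With disjoint frontiers, the preceding lemma applied both ways makes each frontier meet
  the other set, and connectedness puts it inside. Then the open set \<open>D \<union> E\<close>
  contains its own frontier, which is impossible for a nonempty bounded set.\<close>

lemma frontiers_meet_if_equal_measure:
  fixes D E :: "'a::euclidean_space set"
  assumes "open D" "bounded D" "connected D" "connected (frontier D)"
    and "open E" "bounded E" "connected E" "connected (frontier E)"
    and "D \<inter> E \<noteq> {}" "measure lebesgue E = measure lebesgue D"
  shows "frontier D \<inter> frontier E \<noteq> {}"
proof
  assume disj: "frontier D \<inter> frontier E = {}"
  have "frontier E \<inter> D \<noteq> {}" "frontier D \<inter> E \<noteq> {}"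
    using frontiers_meet_if_frontier_disjoint [of D E] frontiers_meet_if_frontier_disjoint [of E D] assms disj
    by (auto simp: Int_commute)
  then have "frontier E \<subseteq> D" "frontier D \<subseteq> E"
    using connected_Int_frontier [of "frontier E" D] connected_Int_frontier [of "frontier D" E] assms disj
    by blast+
  then have "frontier (D \<union> E) \<subseteq> D \<union> E"
    using frontier_Un_subset [of D E] by blast
  then have "frontier (D \<union> E) = {}"
    using assms by (metis frontier_disjoint_eq inf.absorb_iff2 inf_commute open_Un)
  then have "D \<union> E = {} \<or> D \<union> E = UNIV" by (simp add: frontier_eq_empty)
  then show False
    using assms by (metis Int_Un_eq(1) Un_empty bounded_Un inf_bot_left not_bounded_UNIV)
qed

section \<open>Images under homotheties\<close>

lemma frontier_image_affinity:
  fixes D :: "'a::euclidean_space set"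
  assumes "r \<noteq> 0"
  shows "frontier ((\<lambda>x. r *\<^sub>R x + c) ` D) = (\<lambda>x. r *\<^sub>R x + c) ` frontier D"
proof -
  have 1: "(\<lambda>x. r *\<^sub>R x + c) = (+) c \<circ> (*\<^sub>R) r" by (auto simp: add.commute)
  have "linear ((*\<^sub>R) r :: 'a \<Rightarrow> 'a)" "bij ((*\<^sub>R) r :: 'a \<Rightarrow> 'a)"
    using assms by (auto simp: linear_scaleR bij_def inj_on_def surj_def intro!: exI[of _ "_ /\<^sub>R r"])
  then show ?thesis
    unfolding 1 image_comp [symmetric] frontier_def
    by (simp add: closure_translation interior_translation closure_injective_linear_image interior_bijective_linear_image 
       image_set_diff bij_def  inj_on_def)
qed

lemma open_image_affinity:
  fixes D :: "'a::real_normed_vector set"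
  assumes "r \<noteq> 0" "open D"
  shows "open ((\<lambda>x. r *\<^sub>R x + c) ` D)"
  using open_affinity [OF assms(2,1), of c] by (simp add: add.commute)

lemma bounded_image_affinity:
  fixes D :: "'a::real_normed_vector set"
  assumes "bounded D"
  shows "bounded ((\<lambda>x. r *\<^sub>R x + c) ` D)"
  using bounded_translation [OF bounded_scaling [OF assms, of r], of c]
  by (simp add: image_image add.commute)

lemma connected_image_affinity:
  fixes D :: "'a::real_normed_vector set"
  assumes "connected D"
  shows "connected ((\<lambda>x. r *\<^sub>R x + c) ` D)"
  by (intro connected_continuous_image continuous_intros assms)

section \<open>Algebra of Minkowski multiples\<close>

lemma mem_minkowski_multiple_Suc:
  assumes "x \<in> minkowski_multiple A m" "a \<in> A"
  shows "x + a \<in> minkowski_multiple A (Suc m)"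
proof -
  obtain f where f: "x = (\<Sum>j<m. f j)" "\<forall>j<m. f j \<in> A"
    using assms(1) unfolding minkowski_multiple_def by auto
  have "x + a = (\<Sum>j<Suc m. (f(m := a)) j)"
    using f(1) by simp
  moreover have "\<forall>j<Suc m. (f(m := a)) j \<in> A"
    using f(2) assms(2) by (simp add: less_Suc_eq)
  ultimately show ?thesis
    unfolding minkowski_multiple_def by blast
qed

lemma minkowski_multiple_0 [simp]: "minkowski_multiple A 0 = {0}"
  by (auto simp: minkowski_multiple_def)

lemma minkowski_multiple_Suc:
  "minkowski_multiple A (Suc m) = {x + a | x a. x \<in> minkowski_multiple A m \<and> a \<in> A}"
proof
  show "minkowski_multiple A (Suc m) \<subseteq> {x + a | x a. x \<in> minkowski_multiple A m \<and> a \<in> A}"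
  proof
    fix y assume "y \<in> minkowski_multiple A (Suc m)"
    then obtain f where "y = (\<Sum>j<m. f j) + f m" "\<forall>j<Suc m. f j \<in> A"
      unfolding minkowski_multiple_def by auto
    then show "y \<in> {x + a | x a. x \<in> minkowski_multiple A m \<and> a \<in> A}"
      unfolding minkowski_multiple_def by fastforce
  qed
qed (use mem_minkowski_multiple_Suc in blast)

lemma minkowski_multiple_1 [simp]: "minkowski_multiple A (Suc 0) = A"
  by (auto simp: minkowski_multiple_Suc)

lemma minkowski_multiple_mono:
  "A \<subseteq> B \<Longrightarrow> minkowski_multiple A m \<subseteq> minkowski_multiple B m"
  unfolding minkowski_multiple_def by blast

lemma scaleR_mem_minkowski_multiple:
  fixes a :: "'a::real_vector"
  assumes "a \<in> A"
  shows "real m *\<^sub>R a \<in> minkowski_multiple A m"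
proof (induction m)
  case (Suc m)
  then show ?case
    using mem_minkowski_multiple_Suc [OF Suc assms] by (simp add: algebra_simps)
qed simp

text \<open>A copy of \<open>D\<close> reflected in \<open>p\<close> and scaled by \<open>1 / m\<close> is too small to contain \<open>D\<close>,
  so its frontier meets the closure of \<open>D\<close>.\<close>

lemma disc_in_minkowski_frontier:
  fixes D :: "'a::euclidean_space set"
  assumes D: "open D" "bounded D" "connected D" "connected (frontier D)"
    and "p \<in> D" "m \<ge> 2"
  shows "real m *\<^sub>R p \<in> minkowski_multiple (frontier D) m"
  using \<open>m \<ge> 2\<close> \<open>p \<in> D\<close>
proof (induction m arbitrary: p rule: nat_induct_at_least)
  case base
  \<comment> \<open>The reflection in \<open>p\<close> preserves area, and a common frontier point
    \<open>a = 2 p - b\<close> splits \<open>2 p\<close> into two frontier points of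
    \<open>D\<close>.\<close>
  define E where "E = (\<lambda>x. (-1) *\<^sub>R x + 2 *\<^sub>R p) ` D"
  have "p \<in> E" unfolding E_def using base by (intro image_eqI[of _ _ p]) (auto simp: scaleR_2)
  have "frontier D \<inter> frontier E \<noteq> {}"
  proof (rule frontiers_meet_if_equal_measure [OF D])
    show "open E" unfolding E_def by (rule open_image_affinity) (auto simp: D)
    show "bounded E" unfolding E_def by (rule bounded_image_affinity) (auto simp: D)
    show "connected E" unfolding E_def by (rule connected_image_affinity) (auto simp: D)
    show "connected (frontier E)"
      unfolding E_def by (subst frontier_image_affinity) (simp, intro connected_image_affinity D)
    show "measure lebesgue E = measure lebesgue D"
      unfolding E_def by (subst measure_lebesgue_affine) simp
    show "D \<inter> E \<noteq> {}" using base \<open>p \<in> E\<close> by blast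
  qed
  then obtain a b where ab: "a \<in> frontier D" "b \<in> frontier D" "a = (-1) *\<^sub>R b + 2 *\<^sub>R p"
    unfolding E_def by (subst (asm) frontier_image_affinity) auto
  then have "real 2 *\<^sub>R p = b + a" by simp
  also have "\<dots> \<in> minkowski_multiple (frontier D) (Suc (Suc 0))"
    using ab by (intro mem_minkowski_multiple_Suc) auto
  finally show ?case by (simp add: numeral_2_eq_2)
next
  case (Suc m)
  \<comment> \<open>The ratio is chosen so that \<open>b = - l a + (1 + l) p\<close> means
    \<open>m b + a = (m + 1) p\<close>.\<close>
  define l where "l = 1 / real m"
  have l: "0 < l" "l < 1" using Suc(1) by (auto simp: l_def)
  define E where "E = (\<lambda>x. (-l) *\<^sub>R x + (1 + l) *\<^sub>R p) ` D"
  have pE: "p \<in> E" unfolding E_def using Suc.prems by (intro image_eqI[of _ _ p]) (auto simp: algebra_simps)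
  have E: "open E" "bounded E"
    unfolding E_def using l D
    by (simp_all only: open_image_affinity bounded_image_affinity neg_equal_0_iff_equal not_False_eq_True order_less_imp_not_eq2)
  have lm: "D \<in> lmeasurable" "E \<in> lmeasurable"
    using D E lmeasurable_open by auto
  have "frontier E \<inter> closure D \<noteq> {}"
  proof
    assume "frontier E \<inter> closure D = {}"
    then have "frontier E \<inter> D = {}" using closure_subset by blast
    then have "D \<subseteq> E" using connected_Int_frontier [of D E] D pE Suc.prems by blast
    then have "measure lebesgue D \<le> measure lebesgue E"
      using lm by (intro measure_mono_fmeasurable) (auto simp: fmeasurableD)
    also have "\<dots> = l ^ DIM('a) * measure lebesgue D"
      unfolding E_def using l by (subst measure_lebesgue_affine) simp
    finally have "(1 - l ^ DIM('a)) * measure lebesgue D \<le> 0" by (simp add: algebra_simps)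
    moreover have "l ^ DIM('a) < 1" using l by (simp add: power_less_one_iff)
    ultimately have "measure lebesgue D \<le> 0"
      by (metis diff_gt_0_iff_gt mult_le_0_iff not_le)
    then have "negligible D"
      using lm by (metis measure_le_0_iff negligible_iff_measure)
    then show False using open_not_negligible D Suc.prems by blast
  qed
  then obtain a where a: "a \<in> frontier D" "(-l) *\<^sub>R a + (1 + l) *\<^sub>R p \<in> closure D"
    unfolding E_def using l by (subst (asm) frontier_image_affinity) auto
  define b where "b = (-l) *\<^sub>R a + (1 + l) *\<^sub>R p"
  \<comment> \<open>Either \<open>b\<close> lies in \<open>D\<close> and the induction hypothesis
    applies, or it lies on the frontier and is repeated \<open>m\<close> times.\<close>
  have "real m *\<^sub>R b \<in> minkowski_multiple (frontier D) m"
    using Suc.IH [of b] scaleR_mem_minkowski_multiple [of b "frontier D" m] a(2) closure_Un_frontier [of D]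
    by (auto simp: b_def)
  moreover have "real (Suc m) *\<^sub>R p = real m *\<^sub>R b + a"
    using Suc(1) by (simp add: b_def l_def algebra_simps)
  ultimately show ?case
    using mem_minkowski_multiple_Suc a(1) by metis
qed

subsection \<open>Boundary arcs of convex sets\<close>

text \<open>The parameter at which the line through \<open>v\<close> with direction \<open>d\<close>
  enters \<open>F\<close>; the direction \<open>- d\<close> gives the other end of the same chord.
  It is meaningful only when the line meets \<open>F\<close>.\<close>

definition line_start :: "'a::euclidean_space set \<Rightarrow> 'a \<Rightarrow> 'a \<Rightarrow> real" where
  "line_start F d v = Inf {s. v + s *\<^sub>R d \<in> F}"

context
  fixes F :: "'a::euclidean_space set" and d :: 'a
  assumes F: "open F" "convex F" "bounded F" and d: "d \<noteq> 0"
begin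

lemma bdd_below_line: "bdd_below {s. v + s *\<^sub>R d \<in> F}"
proof -
  obtain B where B: "\<And>x. x \<in> F \<Longrightarrow> norm x \<le> B"
    using F(3) bounded_iff by blast
  have "- ((B + norm v) / norm d) \<le> s" if "v + s *\<^sub>R d \<in> F" for s
  proof -
    have "\<bar>s\<bar> * norm d = norm ((v + s *\<^sub>R d) - v)" by simp
    also have "\<dots> \<le> B + norm v"
      using B [OF that] norm_triangle_ineq4 [of "v + s *\<^sub>R d" v] by linarith
    finally have "\<bar>s\<bar> \<le> (B + norm v) / norm d"
      using d by (simp add: field_simps)
    then show ?thesis by linarith
  qed
  then show ?thesis unfolding bdd_below_def by blast
qed

lemma open_line: "open {s. v + s *\<^sub>R d \<in> F}"
proof -
  have "open ((\<lambda>s. v + s *\<^sub>R d) -` F)"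
    by (intro open_vimage F continuous_intros)
  then show ?thesis by (simp add: vimage_def)
qed

lemma line_start_le:
  "v + s *\<^sub>R d \<in> F \<Longrightarrow> line_start F d v \<le> s"
  unfolding line_start_def by (intro cInf_lower bdd_below_line) auto

lemma line_start_frontier:
  assumes "v + s *\<^sub>R d \<in> F"
  shows "v + line_start F d v *\<^sub>R d \<in> frontier F"
proof -
  let ?S = "{s. v + s *\<^sub>R d \<in> F}"
  have "line_start F d v \<in> closure ?S"
    unfolding line_start_def using assms bdd_below_line by (intro closure_contains_Inf) auto
  moreover have "(\<lambda>s. v + s *\<^sub>R d) ` closure ?S \<subseteq> closure F"
    using closure_subset [of F] by (intro image_closure_subset continuous_intros) auto
  ultimately have "v + line_start F d v *\<^sub>R d \<in> closure F" by blast
  moreover have "v + line_start F d v *\<^sub>R d \<notin> F"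
  proof
    assume "v + line_start F d v *\<^sub>R d \<in> F"
    then obtain e where e: "e > 0" "ball (line_start F d v) e \<subseteq> ?S"
      using open_line open_contains_ball by (metis mem_Collect_eq)
    then have "line_start F d v - e/2 \<in> ?S"
      by (intro subsetD[OF e(2)]) (auto simp: dist_real_def)
    then show False using line_start_le[of v "line_start F d v - e/2"] e(1) by simp
  qed
  ultimately show ?thesis
    using F(1) by (simp add: frontier_def interior_open)
qed

lemma line_start_less:
  assumes "v \<in> F"
  shows "line_start F d v < 0"
proof -
  have "line_start F d v \<le> 0"
    using line_start_le[of v 0] assms by simp
  moreover have "line_start F d v \<noteq> 0"
    using line_start_frontier[of v 0] assms F(1) by (auto simp: frontier_def interior_open)
  ultimately show ?thesis by simp
qed

lemma line_start_between:
  assumes "v \<in> F" "line_start F d v < s" "s \<le> 0"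
  shows "v + s *\<^sub>R d \<in> F"
proof -
  have ne: "{s. v + s *\<^sub>R d \<in> F} \<noteq> {}"
    using assms(1) by (auto intro: exI[of _ 0])
  obtain s' where s': "v + s' *\<^sub>R d \<in> F" "s' < s"
    using assms(2) cInf_lessD[OF ne] unfolding line_start_def by auto
  define u where "u = s / s'"
  have u: "0 \<le> u" "u \<le> 1" "u * s' = s"
    using s' assms(3) by (auto simp: u_def divide_simps)
  have "(1 - u) *\<^sub>R v + u *\<^sub>R (v + s' *\<^sub>R d) \<in> F"
    using F(2) assms(1) s'(1) u by (intro convexD) auto
  moreover have "(1 - u) *\<^sub>R v + u *\<^sub>R (v + s' *\<^sub>R d) = v + s *\<^sub>R d"
    using u(3) by (simp add: algebra_simps)
  ultimately show ?thesis by simp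
qed

text \<open>Convex combinations of nearly optimal parameters at two levels are admissible at the
  level in between. Convexity is wanted for the continuity of the arc of left end points.\<close>

lemma convex_on_line_start:
  "convex_on {t. \<exists>s. v + t *\<^sub>R n + s *\<^sub>R d \<in> F} (\<lambda>t. line_start F d (v + t *\<^sub>R n))"
proof (rule convex_onI)
  show "convex {t. \<exists>s. v + t *\<^sub>R n + s *\<^sub>R d \<in> F}"
  proof (rule convexI, clarsimp)
    fix x y a b s s' :: real
    assume h: "0 \<le> a" "0 \<le> b" "a + b = 1" "v + x *\<^sub>R n + s *\<^sub>R d \<in> F" "v + y *\<^sub>R n + s' *\<^sub>R d \<in> F"
    have "a *\<^sub>R (v + x *\<^sub>R n + s *\<^sub>R d) + b *\<^sub>R (v + y *\<^sub>R n + s' *\<^sub>R d) \<in> F"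
      using F(2) h by (intro convexD) auto
    also have "a *\<^sub>R (v + x *\<^sub>R n + s *\<^sub>R d) + b *\<^sub>R (v + y *\<^sub>R n + s' *\<^sub>R d)
       = (a + b) *\<^sub>R v + (a * x + b * y) *\<^sub>R n + (a * s + b * s') *\<^sub>R d"
      by (simp add: algebra_simps)
    finally show "\<exists>s. v + (a * x + b * y) *\<^sub>R n + s *\<^sub>R d \<in> F"
      using h by auto
  qed
next
  fix u x y :: real
  assume u: "0 < u" "u < 1"
    and x: "x \<in> {t. \<exists>s. v + t *\<^sub>R n + s *\<^sub>R d \<in> F}" and y: "y \<in> {t. \<exists>s. v + t *\<^sub>R n + s *\<^sub>R d \<in> F}"
  let ?l = "\<lambda>t. line_start F d (v + t *\<^sub>R n)"
  show "?l ((1 - u) *\<^sub>R x + u *\<^sub>R y) \<le> (1 - u) * ?l x + u * ?l y"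
  proof (rule field_le_epsilon)
    fix e :: real assume e: "0 < e"
    obtain s where s: "v + x *\<^sub>R n + s *\<^sub>R d \<in> F" "s < ?l x + e"
      using cInf_lessD[of "{s. v + x *\<^sub>R n + s *\<^sub>R d \<in> F}" "?l x + e"] x e
      unfolding line_start_def by auto
    obtain s' where s': "v + y *\<^sub>R n + s' *\<^sub>R d \<in> F" "s' < ?l y + e"
      using cInf_lessD[of "{s. v + y *\<^sub>R n + s *\<^sub>R d \<in> F}" "?l y + e"] y e
      unfolding line_start_def by auto
    have "(1 - u) *\<^sub>R (v + x *\<^sub>R n + s *\<^sub>R d) + u *\<^sub>R (v + y *\<^sub>R n + s' *\<^sub>R d) \<in> F"
      using F(2) s s' u by (intro convexD) auto
    also have "(1 - u) *\<^sub>R (v + x *\<^sub>R n + s *\<^sub>R d) + u *\<^sub>R (v + y *\<^sub>R n + s' *\<^sub>R d)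
       = v + ((1 - u) *\<^sub>R x + u *\<^sub>R y) *\<^sub>R n + ((1 - u) * s + u * s') *\<^sub>R d"
      by (simp add: algebra_simps)
    finally have "?l ((1 - u) *\<^sub>R x + u *\<^sub>R y) \<le> (1 - u) * s + u * s'"
      by (rule line_start_le)
    also have "\<dots> \<le> (1 - u) * (?l x + e) + u * (?l y + e)"
      using u s(2) s'(2) by (intro add_mono mult_left_mono) auto
    finally show "?l ((1 - u) *\<^sub>R x + u *\<^sub>R y) \<le> (1 - u) * ?l x + u * ?l y + e"
      by (simp add: algebra_simps)
  qed
qed

lemma continuous_on_line_start:
  assumes "c \<in> F" "z \<in> F"
  shows "continuous_on {0..1} (\<lambda>t. line_start F d (c + t *\<^sub>R (z - c)))"
proof (rule continuous_on_subset)
  let ?J = "{t. \<exists>s. c + t *\<^sub>R (z - c) + s *\<^sub>R d \<in> F}"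
  have "open ((\<lambda>t. c + t *\<^sub>R (z - c) + s *\<^sub>R d) -` F)" for s
    by (intro open_vimage F continuous_intros)
  then have "open (\<Union>s. (\<lambda>t. c + t *\<^sub>R (z - c) + s *\<^sub>R d) -` F)"
    by blast
  moreover have "(\<Union>s. (\<lambda>t. c + t *\<^sub>R (z - c) + s *\<^sub>R d) -` F) = ?J" by auto
  ultimately have "open ?J" by simp
  then show "continuous_on ?J (\<lambda>t. line_start F d (c + t *\<^sub>R (z - c)))"
    by (intro convex_on_continuous convex_on_line_start)
  have "c + t *\<^sub>R (z - c) + 0 *\<^sub>R d \<in> F" if "t \<in> {0..1}" for t
  proof -
    have "(1 - t) *\<^sub>R c + t *\<^sub>R z \<in> F"
      using F(2) assms that by (intro convexD) auto
    then show ?thesis by (simp add: algebra_simps)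
  qed
  then show "{0..1} \<subseteq> ?J" by blast
qed

text \<open>The reflection in \<open>z\<close> of the arc of left end points between the levels of \<open>c\<close> and \<open>z\<close>
  leads from a point of the closure to a point outside, hence it crosses the frontier.\<close>

lemma reflected_arc_meets_frontier:
  assumes "c \<in> F" "z \<in> F"
    and out: "2 *\<^sub>R z - (c + line_start F d c *\<^sub>R d) \<notin> F"
    and cl: "z - line_start F d z *\<^sub>R d \<in> closure F"
  shows "\<exists>a b t. a \<in> frontier F \<and> b \<in> frontier F \<and> a + b = 2 *\<^sub>R z \<and> 0 \<le> t \<and> t \<le> 1 \<and>
    (\<exists>s. a = c + t *\<^sub>R (z - c) + s *\<^sub>R d)"
proof -
  let ?l = "\<lambda>t. line_start F d (c + t *\<^sub>R (z - c))"
  let ?a = "\<lambda>t. c + t *\<^sub>R (z - c) + ?l t *\<^sub>R d"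
  let ?C = "(\<lambda>t. 2 *\<^sub>R z - ?a t) ` {0..1}"
  have conn: "connected ?C"
    using continuous_on_line_start[OF assms(1,2)]
    by (intro connected_continuous_image continuous_intros) auto
  have s0: "2 *\<^sub>R z - ?a 0 \<in> ?C"
    by (rule imageI) simp
  have s0': "2 *\<^sub>R z - ?a 0 \<notin> F"
    using out by simp
  have s1: "2 *\<^sub>R z - ?a 1 \<in> ?C"
    by (rule imageI) simp
  \<comment> \<open>At \<open>t = 1\<close> the arc has reached the chord through \<open>z\<close>
    itself.\<close>
  have s1': "2 *\<^sub>R z - ?a 1 \<in> closure F"
    using cl by (simp add: scaleR_2)
  have "?C \<inter> frontier F \<noteq> {}"
  proof (cases "2 *\<^sub>R z - ?a 1 \<in> F")
    case True
    then show ?thesis using s0 s0' s1 by (intro connected_Int_frontier conn) blast+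
  next
    case False
    with s1' have "2 *\<^sub>R z - ?a 1 \<in> frontier F"
      using F(1) by (simp add: frontier_def interior_open)
    with s1 show ?thesis by blast
  qed
  then obtain t where t: "t \<in> {0..1}" "2 *\<^sub>R z - ?a t \<in> frontier F" by blast
  have "(1 - t) *\<^sub>R c + t *\<^sub>R z \<in> F"
    using F(2) assms t by (intro convexD) auto
  then have "c + t *\<^sub>R (z - c) + 0 *\<^sub>R d \<in> F" by (simp add: algebra_simps)
  then have "?a t \<in> frontier F" by (rule line_start_frontier)
  with t show ?thesis
    by (intro exI[of _ "?a t"] exI[of _ "2 *\<^sub>R z - ?a t"] exI[of _ t]) auto
qed

end

text \<open>Of the two ends of the chord through \<open>z\<close>, the one nearer to
  \<open>z\<close> has its reflection in the closed chord, so the arc on that side can be used. The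
  last conjunct records that the level of \<open>a\<close> is between those of \<open>c\<close> and
  \<open>z\<close>.\<close>

lemma midpoint_of_frontier_points:
  fixes F :: "'a::euclidean_space set"
  assumes F: "open F" "convex F" "bounded F" and d: "d \<noteq> 0" and "c \<in> F" "z \<in> F"
    and p: "2 *\<^sub>R z - (c + line_start F d c *\<^sub>R d) \<notin> F"
    and q: "2 *\<^sub>R z - (c + line_start F (- d) c *\<^sub>R (- d)) \<notin> F"
  shows "\<exists>a b t. a \<in> frontier F \<and> b \<in> frontier F \<and> a + b = 2 *\<^sub>R z \<and> 0 \<le> t \<and> t \<le> 1 \<and>
    (\<exists>s. a = c + t *\<^sub>R (z - c) + s *\<^sub>R d)"
proof -
  have md: "- d \<noteq> 0" using d by simp
  have cl: "z - s *\<^sub>R e \<in> closure F"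
    if "e \<noteq> 0" "s < 0" "line_start F (- e) z \<le> s" for s e
  proof (cases "line_start F (- e) z = s")
    case True
    then show ?thesis
      using line_start_frontier[OF F, of "- e" z 0] \<open>z \<in> F\<close> that
      by (auto simp: frontier_def)
  next
    case False
    then have "z + s *\<^sub>R (- e) \<in> F"
      using that \<open>z \<in> F\<close> by (intro line_start_between F) auto
    then show ?thesis using closure_subset by auto
  qed
  consider "line_start F (- d) z \<le> line_start F d z" | "line_start F d z \<le> line_start F (- d) z"
    by linarith
  then show ?thesis
  proof cases
    case 1
    then show ?thesis
      using reflected_arc_meets_frontier[OF F d \<open>c \<in> F\<close> \<open>z \<in> F\<close> p] cl[OF d] line_start_less[OF F d \<open>z \<in> F\<close>]
      by blast
  next
    case 2
    then have "z - line_start F (- d) z *\<^sub>R (- d) \<in> closure F"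
      using cl[OF md, of "line_start F (- d) z"] line_start_less[OF F md \<open>z \<in> F\<close>] by simp
    then obtain a b t s where "a \<in> frontier F" "b \<in> frontier F" "a + b = 2 *\<^sub>R z" "0 \<le> t" "t \<le> 1"
      "a = c + t *\<^sub>R (z - c) + s *\<^sub>R (- d)"
      using reflected_arc_meets_frontier[OF F md \<open>c \<in> F\<close> \<open>z \<in> F\<close> q] by blast
    then show ?thesis
      by (intro exI[of _ a] exI[of _ b] exI[of _ t]) (auto intro!: exI[of _ "- s"])
  qed
qed

subsection \<open>The missed part of a cut convex set\<close>

text \<open>After multiplication by \<open>m\<close>, split each weight into \<open>m - j\<close>
  and \<open>j\<close> and use one bound on each part. Then \<open>a j\<close> collects
  \<open>(m - j) + (j + 1) = m + 1\<close> times \<open>r\<close>, which is at most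
  \<open>m\<close>.\<close>

lemma sum_le_sum_if_shifted_le:
  fixes a b :: "nat \<Rightarrow> real"
  assumes m: "m > 0" and a: "\<And>j. j < m \<Longrightarrow> 0 \<le> a j"
    and le0: "\<And>j. j < m \<Longrightarrow> b j \<le> r * a j" and le1: "\<And>j. j < m \<Longrightarrow> b (Suc j) \<le> r * a j"
    and r: "r * real (Suc m) \<le> real m"
  shows "(\<Sum>j<Suc m. b j) \<le> (\<Sum>j<m. a j)"
proof -
  have "real m * (\<Sum>j<Suc m. b j) = (\<Sum>j<Suc m. (real m - real j) * b j) + (\<Sum>j<Suc m. real j * b j)"
    by (simp add: sum_distrib_left sum.distrib [symmetric] algebra_simps)
  also have "(\<Sum>j<Suc m. (real m - real j) * b j) = (\<Sum>j<m. (real m - real j) * b j)"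
    by simp
  also have "(\<Sum>j<Suc m. real j * b j) = (\<Sum>j<m. real (Suc j) * b (Suc j))"
    by (subst sum.lessThan_Suc_shift) simp
  also have "(\<Sum>j<m. (real m - real j) * b j) + (\<Sum>j<m. real (Suc j) * b (Suc j))
      \<le> (\<Sum>j<m. (real m - real j) * (r * a j)) + (\<Sum>j<m. real (Suc j) * (r * a j))"
    by (intro add_mono sum_mono mult_left_mono le0 le1) auto
  also have "\<dots> = (\<Sum>j<m. (r * real (Suc m)) * a j)"
    by (simp add: sum.distrib [symmetric] algebra_simps)
  also have "\<dots> \<le> (\<Sum>j<m. real m * a j)"
    using r a by (intro sum_mono mult_right_mono) auto
  also have "\<dots> = real m * (\<Sum>j<m. a j)"
    by (simp add: sum_distrib_left)
  finally show ?thesis using m by simp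
qed

lemma compact_minkowski_multiple:
  fixes X :: "'a::euclidean_space set"
  assumes "compact X"
  shows "compact (minkowski_multiple X m)"
proof (induction m)
  case (Suc m)
  then show ?case
    using compact_sums [OF Suc assms] by (simp add: minkowski_multiple_Suc)
qed simp

lemma convex_shrink_into_open:
  fixes F :: "'a::euclidean_space set"
  assumes "open F" "convex F" "x \<in> F" "y \<in> closure F" "0 < e" "e \<le> 1"
  shows "e *\<^sub>R x + (1 - e) *\<^sub>R y \<in> F"
  using mem_interior_closure_convex_shrink [of F x y e] assms
  by (simp add: interior_open algebra_simps)

text \<open>The level set of \<open>n\<close> through \<open>c\<close> cuts \<open>F\<close>, and
  \<open>d\<close> is a direction inside the cut. The dimension is arbitrary; \<open>p\<close> and
  \<open>q\<close> will be the ends of the chord through \<open>c\<close> along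
  \<open>d\<close>.\<close>

locale cut_convex_domain =
  fixes F :: "'a::euclidean_space set" and c d n :: 'a
  assumes F: "open F" "convex F" "bounded F" and c: "c \<in> F"
    and d: "d \<noteq> 0" and n: "n \<bullet> d = 0"
begin

definition "p = c + line_start F d c *\<^sub>R d"
definition "q = c + line_start F (- d) c *\<^sub>R (- d)"
definition "upper = {x \<in> F. n \<bullet> c < n \<bullet> x}"
definition "upper_frontier = {x \<in> frontier F. n \<bullet> c \<le> n \<bullet> x}"

lemma endpoints: "p \<in> frontier F" "q \<in> frontier F" "n \<bullet> p = n \<bullet> c" "n \<bullet> q = n \<bullet> c"
  using line_start_frontier [OF F, of d c 0] line_start_frontier [OF F, of "- d" c 0] c d n
  by (auto simp: p_def q_def inner_simps)

lemma endpoints_upper_frontier: "p \<in> upper_frontier" "q \<in> upper_frontier"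
  using endpoints by (auto simp: upper_frontier_def)

lemma endpoint_sum:
  "real i *\<^sub>R p + real j *\<^sub>R q \<in> minkowski_multiple upper_frontier (i + j)"
proof (induction j)
  case (Suc j)
  then show ?case
    using mem_minkowski_multiple_Suc [OF Suc endpoints_upper_frontier(2)]
    by (simp add: algebra_simps)
qed (simp add: scaleR_mem_minkowski_multiple endpoints_upper_frontier)

lemma upper_frontier_closure: "upper_frontier \<subseteq> closure F"
  by (auto simp: upper_frontier_def frontier_def)

text \<open>Let \<open>z\<close> be the midpoint of \<open>u\<close> and \<open>v\<close>. The
  points \<open>2 z - p\<close> and \<open>2 z - q\<close> are always above the cut, so if they are
  not in \<open>upper\<close> they are outside \<open>F\<close>, and \<open>z\<close> is then the
  midpoint of two frontier points.\<close>

lemma upper_plus_closure: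
  assumes u: "u \<in> upper" and v: "v \<in> upper \<union> upper_frontier"
  shows "(\<exists>a \<in> upper_frontier. \<exists>b \<in> upper_frontier. u + v = a + b)
    \<or> u + v - p \<in> upper \<or> u + v - q \<in> upper"
proof (rule ccontr)
  assume "\<not> ?thesis"
  then have nab: "\<And>a b. a \<in> upper_frontier \<Longrightarrow> b \<in> upper_frontier \<Longrightarrow> u + v \<noteq> a + b"
    and np: "u + v - p \<notin> upper" and nq: "u + v - q \<notin> upper" by blast+
  define z where "z = (1/2) *\<^sub>R u + (1 - 1/2) *\<^sub>R v"
  have z2: "2 *\<^sub>R z = u + v" by (simp add: z_def scaleR_2 algebra_simps flip: scaleR_add_left)
  have "u \<in> F" "v \<in> closure F"
    using u v upper_frontier_closure closure_subset [of F] by (auto simp: upper_def)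
  then have zF: "z \<in> F" unfolding z_def by (intro convex_shrink_into_open F) auto
  have hz: "n \<bullet> c < n \<bullet> z"
    using u v by (auto simp: z_def upper_def upper_frontier_def inner_simps)
  have h2: "n \<bullet> (u + v) = 2 * (n \<bullet> z)" by (simp flip: z2)
  have "2 *\<^sub>R z - p \<notin> F" "2 *\<^sub>R z - q \<notin> F"
    using np nq hz endpoints h2 by (auto simp: upper_def z2 inner_diff_right)
  then obtain a b t s where ab: "a \<in> frontier F" "b \<in> frontier F" "a + b = 2 *\<^sub>R z" "0 \<le> t" "t \<le> 1"
    "a = c + t *\<^sub>R (z - c) + s *\<^sub>R d"
    using midpoint_of_frontier_points [OF F d c zF] unfolding p_def q_def by blast
  have ha: "n \<bullet> a = n \<bullet> c + t * (n \<bullet> z - n \<bullet> c)"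
    using n by (simp add: ab(6) inner_simps)
  have hb: "n \<bullet> b = 2 * (n \<bullet> z) - n \<bullet> a"
    using arg_cong [OF ab(3), of "\<lambda>x. n \<bullet> x"] by (simp add: inner_add_right)
  \<comment> \<open>The level of \<open>a\<close> is between those of \<open>c\<close> and
    \<open>z\<close>, so that of \<open>b = 2 z - a\<close> is at least that of
    \<open>z\<close>.\<close>
  have "t * (n \<bullet> z - n \<bullet> c) \<le> n \<bullet> z - n \<bullet> c" "0 \<le> t * (n \<bullet> z - n \<bullet> c)"
    using ab(4,5) hz by (simp_all add: mult_left_le_one_le)
  then have "n \<bullet> c \<le> n \<bullet> a" "n \<bullet> c \<le> n \<bullet> b"
    using ha hb hz by linarith+
  then have "a \<in> upper_frontier" "b \<in> upper_frontier"
    using ab(1,2) by (simp_all add: upper_frontier_def)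
  then show False using nab ab(3) z2 by metis
qed

text \<open>Add the summands of \<open>g\<close> one at a time to a residual point of
  \<open>upper\<close>. Each step either splits off one more \<open>p\<close> or \<open>q\<close>
  and keeps a residual point, or turns the whole sum into frontier points.\<close>

lemma upper_plus_minkowski_multiple:
  assumes "u \<in> upper" "g \<in> minkowski_multiple upper_frontier m"
  shows "u + g \<in> minkowski_multiple upper_frontier (Suc m)
    \<or> (\<exists>i j. i + j = m \<and> u + g - (real i *\<^sub>R p + real j *\<^sub>R q) \<in> upper)"
  using assms(2)
proof (induction m arbitrary: g)
  case 0
  then show ?case using assms(1) by simp
next
  case (Suc m)
  then obtain g' x where g: "g = g' + x" "g' \<in> minkowski_multiple upper_frontier m" "x \<in> upper_frontier"
    by (auto simp: minkowski_multiple_Suc)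
  from Suc.IH [OF g(2)] show ?case
  proof
    assume "u + g' \<in> minkowski_multiple upper_frontier (Suc m)"
    from mem_minkowski_multiple_Suc [OF this g(3)] show ?thesis
      by (simp add: g(1) add.assoc)
  next
    assume "\<exists>i j. i + j = m \<and> u + g' - (real i *\<^sub>R p + real j *\<^sub>R q) \<in> upper"
    then obtain i j where ij: "i + j = m" "u + g' - (real i *\<^sub>R p + real j *\<^sub>R q) \<in> upper" by blast
    let ?w = "u + g' - (real i *\<^sub>R p + real j *\<^sub>R q)"
    from upper_plus_closure [OF ij(2), of x] g(3)
    consider a b where "a \<in> upper_frontier" "b \<in> upper_frontier" "?w + x = a + b"
      | "?w + x - p \<in> upper" | "?w + x - q \<in> upper" by blast
    then show ?thesis
    proof cases
      case 1
      have "real i *\<^sub>R p + real j *\<^sub>R q + a + b \<in> minkowski_multiple upper_frontier (Suc (Suc m))"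
        using 1 ij endpoint_sum [of i j] by (intro mem_minkowski_multiple_Suc) auto
      moreover have "real i *\<^sub>R p + real j *\<^sub>R q + a + b = u + g"
        using 1(3) g(1) by (simp add: algebra_simps)
      ultimately show ?thesis by simp
    next
      case 2
      then have "u + g - (real (Suc i) *\<^sub>R p + real j *\<^sub>R q) \<in> upper"
        by (simp add: g(1) algebra_simps)
      then show ?thesis using ij(1) by (metis add_Suc)
    next
      case 3
      then have "u + g - (real i *\<^sub>R p + real (Suc j) *\<^sub>R q) \<in> upper"
        by (simp add: g(1) algebra_simps)
      then show ?thesis using ij(1) by (metis add_Suc_right)
    qed
  qed
qed

text \<open>The \<open>m\<close> copies of \<open>upper\<close> scaled by \<open>1 / m\<close> and lined up along the chord from \<open>p\<close> to \<open>q\<close>.\<close>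

definition "copy m j = {z. real m *\<^sub>R z - (real (m - Suc j) *\<^sub>R p + real j *\<^sub>R q) \<in> upper}"

lemma upper_covered:
  assumes "z \<in> upper" "m > 0"
  shows "real m *\<^sub>R z \<in> minkowski_multiple upper_frontier m \<or> (\<exists>j<m. z \<in> copy m j)"
proof -
  have "real m *\<^sub>R z \<in> minkowski_multiple upper_frontier m
    \<or> (\<exists>i j. Suc (i + j) = m \<and> real m *\<^sub>R z - (real i *\<^sub>R p + real j *\<^sub>R q) \<in> upper)"
    using assms(2)
  proof (induction m rule: nat_induct_non_zero)
    case 1
    then show ?case using assms(1) by simp
  next
    case (Suc m)
    have eq: "real (Suc m) *\<^sub>R z = z + real m *\<^sub>R z" by (simp add: algebra_simps)
    from Suc.IH show ?case
    proof
      assume "real m *\<^sub>R z \<in> minkowski_multiple upper_frontier m"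
      from upper_plus_minkowski_multiple [OF assms(1) this] show ?thesis
        unfolding eq by auto
    next
      assume "\<exists>i j. Suc (i + j) = m \<and> real m *\<^sub>R z - (real i *\<^sub>R p + real j *\<^sub>R q) \<in> upper"
      then obtain i j where ij: "Suc (i + j) = m" "real m *\<^sub>R z - (real i *\<^sub>R p + real j *\<^sub>R q) \<in> upper"
        by blast
      let ?w = "real m *\<^sub>R z - (real i *\<^sub>R p + real j *\<^sub>R q)"
      from upper_plus_closure [OF ij(2), of z] assms(1)
      consider a b where "a \<in> upper_frontier" "b \<in> upper_frontier" "?w + z = a + b"
        | "?w + z - p \<in> upper" | "?w + z - q \<in> upper" by blast
      then show ?thesis
      proof cases
        case 1
        have "real i *\<^sub>R p + real j *\<^sub>R q + a + b \<in> minkowski_multiple upper_frontier (Suc (Suc (i + j)))"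
          using 1 ij endpoint_sum [of i j] by (intro mem_minkowski_multiple_Suc) auto
        moreover have "real i *\<^sub>R p + real j *\<^sub>R q + a + b = real (Suc m) *\<^sub>R z"
          using 1(3) by (simp add: algebra_simps)
        ultimately show ?thesis using ij(1) by simp
      next
        case 2
        then have "real (Suc m) *\<^sub>R z - (real (Suc i) *\<^sub>R p + real j *\<^sub>R q) \<in> upper"
          by (simp add: algebra_simps)
        then show ?thesis using ij(1) by (metis add_Suc)
      next
        case 3
        then have "real (Suc m) *\<^sub>R z - (real i *\<^sub>R p + real (Suc j) *\<^sub>R q) \<in> upper"
          by (simp add: algebra_simps)
        then show ?thesis using ij(1) by (metis add_Suc_right)
      qed
    qed
  qed
  then show ?thesis
  proof
    assume "\<exists>i j. Suc (i + j) = m \<and> real m *\<^sub>R z - (real i *\<^sub>R p + real j *\<^sub>R q) \<in> upper"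
    then obtain i j where ij: "Suc (i + j) = m" "real m *\<^sub>R z - (real i *\<^sub>R p + real j *\<^sub>R q) \<in> upper"
      by blast
    then have "z \<in> copy m j" "j < m" unfolding copy_def by auto
    then show ?thesis by blast
  qed blast
qed

text \<open>A point of a copy averages a point of \<open>upper\<close> with weight
  \<open>1 / m\<close> and a point \<open>y\<close> of the closed chord with weight
  \<open>1 - 1 / m\<close>; the positive weight on the open set keeps it in
  \<open>F\<close>.\<close>

lemma copy_subset_upper:
  assumes "j < m"
  shows "copy m j \<subseteq> upper"
proof
  fix z assume z: "z \<in> copy m j"
  define f where "f = real m *\<^sub>R z - (real (m - Suc j) *\<^sub>R p + real j *\<^sub>R q)"
  have f: "f \<in> F" "n \<bullet> c < n \<bullet> f" using z by (auto simp: copy_def f_def upper_def)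
  have mz: "real m *\<^sub>R z = f + (real (m - Suc j) *\<^sub>R p + real j *\<^sub>R q)" by (simp add: f_def)
  have "real m * (n \<bullet> z) = n \<bullet> f + (real (m - Suc j) + real j) * (n \<bullet> c)"
    using arg_cong [OF mz, of "\<lambda>x. n \<bullet> x"] endpoints by (simp add: inner_simps algebra_simps)
  also have "real (m - Suc j) + real j = real m - 1" using assms by (simp add: of_nat_diff)
  finally have "real m * (n \<bullet> z) > real m * (n \<bullet> c)" using f(2) by (simp add: algebra_simps)
  then have h: "n \<bullet> c < n \<bullet> z" using assms by simp
  show "z \<in> upper"
  \<comment> \<open>For \<open>m = 1\<close> the weights of \<open>y\<close> would have denominator
    zero, but the only copy is \<open>upper\<close> itself.\<close>
  proof (cases "m = 1")
    case True
    then show ?thesis using assms z by (simp add: copy_def)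
  next
    case False
    define y where "y = (real (m - Suc j) / (real m - 1)) *\<^sub>R p + (real j / (real m - 1)) *\<^sub>R q"
    have m: "real m > 1" using False assms by simp
    have "y \<in> closure F" unfolding y_def
    proof (rule convexD)
      show "convex (closure F)" using F by (simp add: convex_closure)
      show "p \<in> closure F" "q \<in> closure F" using endpoints by (auto simp: frontier_def)
      show "real (m - Suc j) / (real m - 1) + real j / (real m - 1) = 1"
        using m assms by (simp add: of_nat_diff flip: add_divide_distrib)
    qed (use m in auto)
    then have "(1 / real m) *\<^sub>R f + (1 - 1 / real m) *\<^sub>R y \<in> F"
      using m f by (intro convex_shrink_into_open F) auto
    moreover have "(1 / real m) *\<^sub>R f + (1 - 1 / real m) *\<^sub>R y = z"
    proof -
      have "real m *\<^sub>R ((1 / real m) *\<^sub>R f + (1 - 1 / real m) *\<^sub>R y) = f + (real m - 1) *\<^sub>R y"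
        using m by (simp add: algebra_simps)
      also have "(real m - 1) *\<^sub>R y = real (m - Suc j) *\<^sub>R p + real j *\<^sub>R q"
        using m by (simp add: y_def scaleR_add_right)
      finally have "real m *\<^sub>R ((1 / real m) *\<^sub>R f + (1 - 1 / real m) *\<^sub>R y) = real m *\<^sub>R z"
        by (simp add: mz)
      then show ?thesis using m by simp
    qed
    ultimately show ?thesis using h by (simp add: upper_def)
  qed
qed

end

locale cut_convex_domain_in = cut_convex_domain +
  fixes X
  assumes X: "compact X" "upper_frontier \<subseteq> X"
begin

text \<open>Copies may overlap, so each missed point is charged to the first copy containing it;
  the contractions towards \<open>p\<close> and \<open>q\<close> respect this choice.\<close>

definition "missed m = {z \<in> upper. real m *\<^sub>R z \<notin> minkowski_multiple X m}"
definition "piece m j = missed m \<inter> (copy m j - (\<Union>i<j. copy m i))"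

lemma open_upper: "open upper"
proof -
  have "upper = F \<inter> {x. n \<bullet> c < n \<bullet> x}" by (auto simp: upper_def)
  then show ?thesis using F by (simp add: open_Int open_halfspace_gt)
qed

lemma open_copy: "open (copy m j)"
proof -
  have "copy m j = (\<lambda>z. real m *\<^sub>R z - (real (m - Suc j) *\<^sub>R p + real j *\<^sub>R q)) -` upper"
    by (auto simp: copy_def)
  then show ?thesis by (auto intro!: open_vimage open_upper continuous_intros)
qed

lemma open_missed: "open (missed m)"
proof -
  have "missed m = upper - (\<lambda>z. real m *\<^sub>R z) -` minkowski_multiple X m"
    by (auto simp: missed_def)
  moreover have "closed ((\<lambda>z. real m *\<^sub>R z) -` minkowski_multiple X m)"
    using compact_minkowski_multiple [OF X(1)]
    by (intro continuous_closed_vimage compact_imp_closed continuous_intros) auto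
  ultimately show ?thesis using open_upper by (simp add: open_Diff)
qed

lemma missed_lmeasurable: "missed m \<in> lmeasurable"
  using F(3) open_missed by (intro lmeasurable_open) (auto simp: missed_def upper_def intro: bounded_subset)

lemma borel_piece: "piece m j \<in> sets borel"
  unfolding piece_def
  by (intro sets.Int sets.Diff borel_open open_missed open_copy open_UN ballI)

lemma piece_lmeasurable: "piece m j \<in> lmeasurable"
  using borel_piece bounded_subset [OF F(3), of "piece m j"]
  by (intro bounded_set_imp_lmeasurable) (auto simp: piece_def missed_def upper_def)

lemma missed_eq_UN_piece:
  assumes "m > 0"
  shows "missed m = (\<Union>j<m. piece m j)"
proof
  show "missed m \<subseteq> (\<Union>j<m. piece m j)"
  proof
    fix z assume z: "z \<in> missed m"
    then have "\<exists>j<m. z \<in> copy m j"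
      using upper_covered [of z m] minkowski_multiple_mono [OF X(2), of m] assms
      by (auto simp: missed_def)
    then obtain j where "j < m" "z \<in> copy m j" "\<forall>i<j. z \<notin> copy m i"
      using exists_least_iff [of "\<lambda>j. j < m \<and> z \<in> copy m j"] by (meson order.strict_trans)
    then show "z \<in> (\<Union>j<m. piece m j)"
      using z by (auto simp: piece_def)
  qed
qed (auto simp: piece_def)

lemma disjoint_piece: "disjoint_family_on (piece m) A"
  unfolding disjoint_family_on_def piece_def by (auto simp: neq_iff)

lemma measure_missed:
  assumes "m > 0"
  shows "measure lebesgue (missed m) = (\<Sum>j<m. measure lebesgue (piece m j))"
  unfolding missed_eq_UN_piece [OF assms]
proof (rule measure_finite_Union)
  show "piece m ` {..<m} \<subseteq> sets lebesgue"
    using fmeasurableD [OF piece_lmeasurable] by blast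
  show "emeasure lebesgue (piece m j) \<noteq> \<infinity>" for j
    using fmeasurableD2 [OF piece_lmeasurable] by simp
qed (simp_all add: disjoint_piece)

text \<open>The homothety \<open>?f\<close> of ratio \<open>m / (m + 1)\<close> fixes
  \<open>e\<close>, and the assumption \<open>sub\<close> is phrased with its inverse.\<close>

lemma measure_piece_Suc_le:
  assumes m: "m > 0" and e: "e \<in> X"
    and sub: "\<And>z. z \<in> piece (Suc m) i \<Longrightarrow> (1 / real m) *\<^sub>R (real (Suc m) *\<^sub>R z - e) \<in> piece m j"
  shows "measure lebesgue (piece (Suc m) i) \<le> (real m / real (Suc m)) ^ DIM('a) * measure lebesgue (piece m j)"
proof -
  let ?f = "\<lambda>z. (real m / real (Suc m)) *\<^sub>R z + (1 / real (Suc m)) *\<^sub>R e"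
  have "piece (Suc m) i \<subseteq> ?f ` piece m j"
  proof
    fix z assume "z \<in> piece (Suc m) i"
    moreover have "z = ?f ((1 / real m) *\<^sub>R (real (Suc m) *\<^sub>R z - e))"
      using m by (simp add: scaleR_diff_right del: of_nat_Suc)
    ultimately show "z \<in> ?f ` piece m j" using sub by blast
  qed
  moreover have "?f ` piece m j \<in> lmeasurable"
  proof (rule bounded_set_imp_lmeasurable)
    show "bounded (?f ` piece m j)"
      using bounded_subset [OF F(3), of "piece m j"]
      by (intro bounded_image_affinity) (auto simp: piece_def missed_def upper_def)
    \<comment> \<open>As a preimage under the continuous inverse, the image is Borel.\<close>
    have "?f ` piece m j = (\<lambda>z. (1 / real m) *\<^sub>R (real (Suc m) *\<^sub>R z - e)) -` piece m j"
      using m by (auto simp: scaleR_diff_right scaleR_add_right image_iff simp del: of_nat_Suc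
          intro!: bexI [of _ "(1 / real m) *\<^sub>R (real (Suc m) *\<^sub>R _ - e)"])
    moreover have "\<dots> \<in> sets borel"
      by (intro measurable_sets_borel [OF _ borel_piece] borel_measurable_continuous_onI continuous_intros)
    ultimately show "?f ` piece m j \<in> sets lebesgue" by simp
  qed
  ultimately have "measure lebesgue (piece (Suc m) i) \<le> measure lebesgue (?f ` piece m j)"
    using piece_lmeasurable by (intro measure_mono_fmeasurable) (auto simp: fmeasurableD)
  also have "\<dots> = (real m / real (Suc m)) ^ DIM('a) * measure lebesgue (piece m j)"
    by (subst measure_lebesgue_affine) simp
  finally show ?thesis .
qed

text \<open>A representation by \<open>m\<close> summands would, with \<open>e\<close> as one more
  summand, represent \<open>(m + 1) z\<close>.\<close>

lemma not_in_minkowski_multiple_contract: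
  assumes "m > 0" "z \<in> missed (Suc m)" "e \<in> X"
  shows "real m *\<^sub>R ((1 / real m) *\<^sub>R (real (Suc m) *\<^sub>R z - e)) \<notin> minkowski_multiple X m"
proof
  assume "real m *\<^sub>R ((1 / real m) *\<^sub>R (real (Suc m) *\<^sub>R z - e)) \<in> minkowski_multiple X m"
  then have "real (Suc m) *\<^sub>R z - e \<in> minkowski_multiple X m" using assms(1) by simp
  from mem_minkowski_multiple_Suc [OF this assms(3)] show False
    using assms(2) by (simp add: missed_def)
qed

text \<open>Dropping one \<open>p\<close> matches the copies of index below \<open>m\<close> with
  equal index, so the first copy containing the point stays the first.\<close>

lemma piece_contract_p:
  assumes "j < m" "z \<in> piece (Suc m) j"
  shows "(1 / real m) *\<^sub>R (real (Suc m) *\<^sub>R z - p) \<in> piece m j"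
proof -
  let ?z = "(1 / real m) *\<^sub>R (real (Suc m) *\<^sub>R z - p)"
  have *: "?z \<in> copy m i \<longleftrightarrow> z \<in> copy (Suc m) i" if "i < m" for i
  proof -
    have eq1: "real m *\<^sub>R ?z = real (Suc m) *\<^sub>R z - p" using assms by (simp del: of_nat_Suc)
    have eq2: "real (Suc m - Suc i) *\<^sub>R p = p + real (m - Suc i) *\<^sub>R p"
      using that by (simp add: Suc_diff_Suc [symmetric] algebra_simps del: Suc_diff_Suc)
    show ?thesis
      unfolding copy_def mem_Collect_eq eq1 eq2 by (simp only: diff_diff_eq add.assoc)
  qed
  have "?z \<in> copy m j" "\<forall>i<j. ?z \<notin> copy m i"
    using assms * by (auto simp: piece_def)
  moreover have "?z \<in> missed m"
    using copy_subset_upper [OF assms(1)] \<open>?z \<in> copy m j\<close>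
      not_in_minkowski_multiple_contract [of m z p] assms X endpoints_upper_frontier
    by (auto simp: missed_def piece_def)
  ultimately show ?thesis by (auto simp: piece_def)
qed

text \<open>Dropping one \<open>q\<close> lowers every index by one, which again preserves the order
  of the copies.\<close>

lemma piece_contract_q:
  assumes "j < m" "z \<in> piece (Suc m) (Suc j)"
  shows "(1 / real m) *\<^sub>R (real (Suc m) *\<^sub>R z - q) \<in> piece m j"
proof -
  let ?z = "(1 / real m) *\<^sub>R (real (Suc m) *\<^sub>R z - q)"
  have *: "?z \<in> copy m i \<longleftrightarrow> z \<in> copy (Suc m) (Suc i)" if "i < m" for i
  proof -
    have eq1: "real m *\<^sub>R ?z = real (Suc m) *\<^sub>R z - q" using assms by (simp del: of_nat_Suc)
    have eq2: "real (Suc i) *\<^sub>R q = q + real i *\<^sub>R q"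
      by (simp add: algebra_simps)
    show ?thesis
      unfolding copy_def mem_Collect_eq eq1 eq2 by (simp only: diff_Suc_Suc diff_diff_eq add_ac)
  qed
  have "?z \<in> copy m j" "\<forall>i<j. ?z \<notin> copy m i"
    using assms * by (auto simp: piece_def)
  moreover have "?z \<in> missed m"
    using copy_subset_upper [OF assms(1)] \<open>?z \<in> copy m j\<close>
      not_in_minkowski_multiple_contract [of m z q] assms X endpoints_upper_frontier
    by (auto simp: missed_def piece_def)
  ultimately show ?thesis by (auto simp: piece_def)
qed

lemma measure_missed_Suc_le:
  assumes "m > 0"
  shows "measure lebesgue (missed (Suc m)) \<le> measure lebesgue (missed m)"
proof -
  let ?r = "(real m / real (Suc m)) ^ DIM('a)"
  have pq: "p \<in> X" "q \<in> X" using X endpoints_upper_frontier by auto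
  \<comment> \<open>The averaging needs a single factor \<open>m / (m + 1)\<close>, and the
    dimension is at least one.\<close>
  have "?r \<le> real m / real (Suc m)"
    using power_decreasing [of 1 "DIM('a)" "real m / real (Suc m)"] by (simp add: DIM_ge_Suc0)
  then have "?r * real (Suc m) \<le> real m"
    by (simp add: pos_le_divide_eq)
  then have "(\<Sum>j<Suc m. measure lebesgue (piece (Suc m) j)) \<le> (\<Sum>j<m. measure lebesgue (piece m j))"
    using measure_piece_Suc_le [OF assms pq(1) piece_contract_p]
      measure_piece_Suc_le [OF assms pq(2) piece_contract_q]
    by (intro sum_le_sum_if_shifted_le [OF assms]) auto
  then show ?thesis
    using measure_missed [OF assms] measure_missed [of "Suc m"] by simp
qed

end

subsection \<open>The removed disc meets the boundary of the hull in one chord\<close>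

lemma orthogonal_direction_real2:
  fixes a :: "real^2"
  assumes "a \<noteq> 0"
  obtains d where "d \<noteq> 0" "a \<bullet> d = 0" "\<And>v. a \<bullet> v = 0 \<Longrightarrow> \<exists>s. v = s *\<^sub>R d"
proof
  define d :: "real^2" where "d = vector [- a$2, a$1]"
  have dd: "d$1 = - a$2" "d$2 = a$1" by (simp_all add: d_def)
  have aa: "a$1 \<noteq> 0 \<or> a$2 \<noteq> 0" using assms by (simp add: vec_eq_iff forall_2)
  show "d \<noteq> 0" using aa by (auto simp: vec_eq_iff forall_2 dd)
  show "a \<bullet> d = 0" by (simp add: inner_vec_def sum_2 dd)
  fix v :: "real^2" assume "a \<bullet> v = 0"
  then have av: "a$1 * v$1 + a$2 * v$2 = 0" by (simp add: inner_vec_def sum_2)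
  show "\<exists>s. v = s *\<^sub>R d"
  proof (cases "a$1 = 0")
    case True
    then show ?thesis using aa av
      by (intro exI [of _ "- v$1 / a$2"]) (simp add: vec_eq_iff forall_2 dd)
  next
    case False
    then show ?thesis using av
      by (intro exI [of _ "v$2 / a$1"]) (simp add: vec_eq_iff forall_2 dd field_simps)
  qed
qed

lemma scaled_minkowski_multiple_subset_hull:
  fixes X :: "'a::real_vector set"
  assumes "m > 0" "real m *\<^sub>R z \<in> minkowski_multiple X m"
  shows "z \<in> convex hull X"
proof -
  obtain f where f: "real m *\<^sub>R z = (\<Sum>j<m. f j)" "\<forall>j<m. f j \<in> X"
    using assms(2) unfolding minkowski_multiple_def by blast
  have "z = (1 / real m) *\<^sub>R (real m *\<^sub>R z)" using assms(1) by simp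
  also have "\<dots> = (\<Sum>j<m. (1 / real m) *\<^sub>R f j)"
    by (simp add: f(1) scaleR_sum_right)
  also have "\<dots> \<in> convex hull X"
    using assms(1) f(2) by (intro convex_sum) (auto simp: hull_inc)
  finally show ?thesis .
qed

text \<open>The supporting line through \<open>z\<close> cuts the hull in a face spanned by some
  \<open>S \<subseteq> X\<close>. If \<open>v\<close> were outside the hull, no point of
  \<open>S\<close> could lie between \<open>z\<close> and \<open>v\<close>, where \<open>F\<close>
  is, nor beyond \<open>v\<close>. So \<open>S\<close> would lie strictly on the other side of
  \<open>z\<close>, although \<open>z\<close> is in its hull.\<close>

lemma supporting_section_subset_hull:
  fixes X F :: "(real^2) set"
  assumes X: "compact X" and F: "convex F" "F \<inter> X = {}" and a: "a \<noteq> 0"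
    and z: "z \<in> F" "z \<in> convex hull X" and supp: "\<And>x. x \<in> convex hull X \<Longrightarrow> a \<bullet> z \<le> a \<bullet> x"
    and v: "v \<in> F" "a \<bullet> v = a \<bullet> z"
  shows "v \<in> convex hull X"
proof (rule ccontr)
  assume nv: "v \<notin> convex hull X"
  have "convex hull X \<inter> {x. a \<bullet> x = a \<bullet> z} face_of convex hull X"
    using supp by (intro face_of_Int_supporting_hyperplane_ge) auto
  then obtain S where S: "S \<subseteq> X" "convex hull X \<inter> {x. a \<bullet> x = a \<bullet> z} = convex hull S"
    using face_of_convex_hull_subset [OF X] by metis
  obtain d where d: "\<And>v. a \<bullet> v = 0 \<Longrightarrow> \<exists>s. v = s *\<^sub>R d"
    using orthogonal_direction_real2 [OF a] by metis
  obtain s where s: "v - z = s *\<^sub>R d" using d [of "v - z"] v(2) by (auto simp: inner_diff_right)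
  have "v \<noteq> z" using nv z by auto
  then have s0: "s \<noteq> 0" using s by auto
  have "S \<subseteq> {x. (v - z) \<bullet> x < (v - z) \<bullet> z}"
  proof
    fix x assume x: "x \<in> S"
    then have xW: "x \<in> convex hull X" "a \<bullet> x = a \<bullet> z"
      using S(2) hull_inc [of x S convex] by blast+
    then obtain t where t: "x - z = t *\<^sub>R d" using d [of "x - z"] by (auto simp: inner_diff_right)
    \<comment> \<open>The coordinate of \<open>x\<close> on the line, with \<open>z\<close> at 0 and
      \<open>v\<close> at 1.\<close>
    define r where "r = t / s"
    have r: "x = z + r *\<^sub>R (v - z)"
      using t s s0 by (simp add: r_def algebra_simps)
    have "r < 0"
    proof (rule ccontr)
      assume "\<not> r < 0"
      then consider "0 \<le> r" "r \<le> 1" | "r > 1" by linarith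
      then show False
      proof cases
        case 1
        then have "(1 - r) *\<^sub>R z + r *\<^sub>R v \<in> F"
          using F z v by (intro convexD) auto
        then have "x \<in> F" by (simp add: r algebra_simps)
        then show False using x S(1) F(2) by blast
      next
        case 2
        then have "(1 - 1 / r) *\<^sub>R z + (1 / r) *\<^sub>R x \<in> convex hull X"
          using z xW by (intro convexD) auto
        moreover have "(1 - 1 / r) *\<^sub>R z + (1 / r) *\<^sub>R x = v"
          using 2 by (simp add: r algebra_simps)
        ultimately show False using nv by simp
      qed
    qed
    moreover have "(v - z) \<bullet> x = (v - z) \<bullet> z + r * ((v - z) \<bullet> (v - z))"
      by (simp add: r inner_simps algebra_simps)
    moreover have "(v - z) \<bullet> (v - z) > 0" using \<open>v \<noteq> z\<close> by simp
    ultimately show "x \<in> {x. (v - z) \<bullet> x < (v - z) \<bullet> z}"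
      by (simp add: mult_neg_pos)
  qed
  then have "convex hull S \<subseteq> {x. (v - z) \<bullet> x < (v - z) \<bullet> z}"
    by (intro hull_minimal convex_halfspace_lt)
  moreover have "z \<in> convex hull S" using z S(2) by blast
  ultimately show False by blast
qed

lemma supporting_hyperplane_frontier:
  fixes W :: "'a::euclidean_space set"
  assumes "convex W" "interior W \<noteq> {}" "z \<in> frontier W" "z \<in> W"
  obtains a where "a \<noteq> 0" "\<And>x. x \<in> W \<Longrightarrow> a \<bullet> z \<le> a \<bullet> x"
proof -
  have "rel_interior W = interior W"
    using assms by (simp add: rel_interior_nonempty_interior)
  then have "z \<notin> rel_interior W"
    using assms(3) by (auto simp: frontier_def)
  then show ?thesis
    using supporting_hyperplane_rel_boundary [OF assms(1,4)] that by metis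
qed

lemma supporting_strict_interior:
  fixes a :: "'a::euclidean_space"
  assumes "a \<noteq> 0" "\<And>x. x \<in> W \<Longrightarrow> b \<le> a \<bullet> x" "w \<in> interior W"
  shows "b < a \<bullet> w"
proof -
  have "interior W \<subseteq> interior {x. b \<le> a \<bullet> x}"
    using assms(2) by (intro interior_mono) auto
  then show ?thesis using assms(1,3) by (auto simp: interior_halfspace_ge)
qed

text \<open>\<open>trapped\<close> is the trace of the other discs: \<open>K - X\<close> is covered
  by disjoint open sets, so a connected part of it cannot pass from \<open>F\<close> to another
  one.\<close>

locale convex_body_removed_disc =
  fixes K X F :: "(real^2) set"
  assumes K: "compact K" "convex K" and X: "compact X" "X \<subseteq> K"
    and hull_interior: "interior (convex hull X) \<noteq> {}"
    and F: "open F" "convex F" "F \<inter> X = {}"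
    and trapped: "\<And>S. connected S \<Longrightarrow> S \<subseteq> K - X \<Longrightarrow> S \<inter> F \<noteq> {} \<Longrightarrow> S \<subseteq> F"
    and arc_connected: "connected (F \<inter> frontier K)"
begin

lemma hull_subset: "convex hull X \<subseteq> K"
  using K X by (simp add: hull_minimal)

lemma frontier_hull_subset: "frontier (convex hull X) \<subseteq> convex hull X"
  using X by (simp add: compact_convex_hull compact_imp_closed frontier_subset_closed)

text \<open>The ray from \<open>z\<close> leaves the supporting half-plane at once and so avoids
  \<open>X\<close>; up to the frontier of \<open>K\<close> it is trapped in
  \<open>F\<close>.\<close>

lemma exit_point:
  assumes z: "z \<in> F" "z \<in> convex hull X" and supp: "\<And>x. x \<in> convex hull X \<Longrightarrow> a \<bullet> z \<le> a \<bullet> x"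
    and e: "a \<bullet> e < 0"
  obtains s where "s \<ge> 0" "z + s *\<^sub>R e \<in> F \<inter> frontier K"
proof (cases "z \<in> frontier K")
  case True
  then show ?thesis using that [of 0] z by simp
next
  case False
  then have "z \<in> interior K"
    using z hull_subset closure_subset [of K] by (auto simp: frontier_def)
  moreover have "e \<noteq> 0" using e by auto
  ultimately obtain s where s: "s > 0" "z + s *\<^sub>R e \<in> frontier K"
      "\<And>t. 0 \<le> t \<Longrightarrow> t < s \<Longrightarrow> z + t *\<^sub>R e \<in> interior K"
    using ray_to_frontier [of K z e] K compact_imp_bounded by metis
  let ?S = "(\<lambda>t. z + t *\<^sub>R e) ` {0..s}"
  have "?S \<subseteq> F"
  proof (rule trapped)
    show "connected ?S"
      by (intro connected_continuous_image continuous_intros) auto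
    show "?S \<inter> F \<noteq> {}" using z s(1) by force
    show "?S \<subseteq> K - X"
    proof clarsimp
      fix t assume t: "0 \<le> t" "t \<le> s"
      have "z + t *\<^sub>R e \<in> K"
        using s(2) s(3) [of t] t interior_subset [of K] frontier_subset_closed [of K] K compact_imp_closed
        by (cases "t = s") auto
      moreover have "z + t *\<^sub>R e \<notin> X"
      proof (cases "t = 0")
        case True
        then show ?thesis using z F by auto
      next
        case False
        then have "a \<bullet> (z + t *\<^sub>R e) < a \<bullet> z"
          using t e by (simp add: inner_simps mult_pos_neg)
        then show ?thesis using supp hull_inc [of "z + t *\<^sub>R e" X convex] by force
      qed
      ultimately show "z + t *\<^sub>R e \<in> K \<and> z + t *\<^sub>R e \<notin> X" by simp
    qed
  qed
  moreover have "z + s *\<^sub>R e \<in> ?S" using s(1) by (intro imageI) simp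
  ultimately have "z + s *\<^sub>R e \<in> F" by blast
  then show ?thesis using that [of s] s by simp
qed

text \<open>Otherwise \<open>F\<close> would leave \<open>K\<close> beyond two different edges of the hull. The part of
  \<open>F \<inter> frontier K\<close> not beyond the first edge is then separated from the part beyond it: points
  close to that edge on the inner side project onto it from \<open>w\<close>, hence are interior to \<open>K\<close>.\<close>

lemma frontier_hull_in_line:
  assumes y: "y \<in> F" "y \<in> frontier (convex hull X)" and z: "z \<in> F" "z \<in> frontier (convex hull X)"
    and a: "a \<noteq> 0" and supp: "\<And>x. x \<in> convex hull X \<Longrightarrow> a \<bullet> y \<le> a \<bullet> x"
  shows "a \<bullet> z = a \<bullet> y"
proof (rule ccontr)
  assume "a \<bullet> z \<noteq> a \<bullet> y"
  have yW: "y \<in> convex hull X" and zW: "z \<in> convex hull X"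
    using y z frontier_hull_subset by auto
  have az: "a \<bullet> y < a \<bullet> z" using \<open>a \<bullet> z \<noteq> a \<bullet> y\<close> supp [OF zW] by simp
  obtain b where b: "b \<noteq> 0" "\<And>x. x \<in> convex hull X \<Longrightarrow> b \<bullet> z \<le> b \<bullet> x"
    using supporting_hyperplane_frontier [OF convex_convex_hull hull_interior z(2) zW] by metis
  \<comment> \<open>Otherwise \<open>y\<close> lies on the supporting line at \<open>z\<close>.
    Points of \<open>F\<close> on that line slightly beyond \<open>y\<close> would be in the hull,
    yet below the level of \<open>y\<close> for \<open>a\<close>.\<close>
  have "b \<bullet> y \<noteq> b \<bullet> z"
  proof
    assume eq: "b \<bullet> y = b \<bullet> z"
    have "open ((\<lambda>t. y - t *\<^sub>R (z - y)) -` F)"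
      using F by (intro open_vimage continuous_intros)
    then obtain r where r: "r > 0" "ball 0 r \<subseteq> (\<lambda>t. y - t *\<^sub>R (z - y)) -` F"
      using y(1) open_contains_ball [of "(\<lambda>t. y - t *\<^sub>R (z - y)) -` F"] by force
    then have "y - (r/2) *\<^sub>R (z - y) \<in> F"
      using subsetD [OF r(2), of "r/2"] by simp
    moreover have "b \<bullet> (y - (r/2) *\<^sub>R (z - y)) = b \<bullet> z"
      using eq by (simp add: inner_simps)
    ultimately have "y - (r/2) *\<^sub>R (z - y) \<in> convex hull X"
      using supporting_section_subset_hull [OF X(1) F(2,3) b(1) z(1) zW b(2)] by blast
    then have "a \<bullet> y \<le> a \<bullet> (y - (r/2) *\<^sub>R (z - y))" by (rule supp)
    also have "\<dots> = a \<bullet> y - (r/2) * (a \<bullet> z - a \<bullet> y)" by (simp add: inner_simps)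
    finally have "(r/2) * (a \<bullet> z - a \<bullet> y) \<le> 0" by simp
    moreover have "(r/2) * (a \<bullet> z - a \<bullet> y) > 0" using r(1) az by simp
    ultimately show False by simp
  qed
  then have "b \<bullet> z < b \<bullet> y" using b(2) [OF yW] by simp
  \<comment> \<open>Following the line through \<open>y\<close> and \<open>z\<close> both ways gives
    two points of \<open>F \<inter> frontier K\<close>, one in \<open>V\<close> and one outside
    it.\<close>
  then obtain s where s: "s \<ge> 0" "z + s *\<^sub>R (z - y) \<in> F \<inter> frontier K"
    using exit_point [OF z(1) zW b(2), of "z - y"] by (auto simp: inner_simps)
  obtain s' where s': "s' \<ge> 0" "y + s' *\<^sub>R (y - z) \<in> F \<inter> frontier K"
    using exit_point [OF y(1) yW supp, of "y - z"] az by (auto simp: inner_simps)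
  obtain w where w: "w \<in> interior (convex hull X)" using hull_interior by blast
  have aw: "a \<bullet> y < a \<bullet> w" using supporting_strict_interior [OF a supp w] by simp
  have wK: "w \<in> interior K" using w interior_mono [OF hull_subset] by blast
  \<comment> \<open>The central projection from \<open>w\<close> onto the supporting line at
    \<open>y\<close>. It fixes that line, so the second part of \<open>U\<close> adds an open
    neighbourhood of the section of \<open>F\<close> by the line.\<close>
  define \<pi> where "\<pi> v = w + ((a \<bullet> w - a \<bullet> y) / (a \<bullet> w - a \<bullet> v)) *\<^sub>R (v - w)" for v
  define U where "U = {x. a \<bullet> x < a \<bullet> y} \<union> ({x. a \<bullet> x < a \<bullet> w} \<inter> \<pi> -` F)"
  define V where "V = {x. a \<bullet> y < a \<bullet> x}"
  let ?C = "F \<inter> frontier K"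
  have "continuous_on {x. a \<bullet> x < a \<bullet> w} \<pi>"
    unfolding \<pi>_def by (intro continuous_intros) auto
  then have "open U" unfolding U_def
    by (intro open_Un continuous_open_preimage open_halfspace_lt F)
  moreover have "open V" unfolding V_def by (rule open_halfspace_gt)
  moreover have cover: "?C \<subseteq> U \<union> V"
  proof
    fix x assume x: "x \<in> ?C"
    have "\<pi> x = x" if "a \<bullet> x = a \<bullet> y" using that aw by (simp add: \<pi>_def)
    then show "x \<in> U \<union> V" using x aw by (cases "a \<bullet> x" "a \<bullet> y" rule: linorder_cases) (auto simp: U_def V_def)
  qed
  moreover have disj: "U \<inter> V \<inter> ?C = {}"
  proof (rule ccontr)
    assume "U \<inter> V \<inter> ?C \<noteq> {}"
    then obtain v where v: "v \<in> U" "v \<in> V" "v \<in> frontier K" by blast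
    then have av: "a \<bullet> y < a \<bullet> v" "a \<bullet> v < a \<bullet> w" and pF: "\<pi> v \<in> F"
      by (auto simp: U_def V_def)
    define l where "l = (a \<bullet> w - a \<bullet> y) / (a \<bullet> w - a \<bullet> v)"
    have l: "l > 1" using av by (simp add: l_def field_simps)
    have "a \<bullet> \<pi> v = a \<bullet> w + l * (a \<bullet> v - a \<bullet> w)"
      by (simp add: \<pi>_def l_def inner_simps)
    also have "l * (a \<bullet> v - a \<bullet> w) = a \<bullet> y - a \<bullet> w"
      using av by (simp add: l_def field_simps)
    finally have ap: "a \<bullet> \<pi> v = a \<bullet> y" by simp
    then have "\<pi> v \<in> convex hull X"
      using supporting_section_subset_hull [OF X(1) F(2,3) a y(1) yW supp pF] by simp
    then have "\<pi> v \<in> closure K" using hull_subset closure_subset by blast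
    then have "open_segment w (\<pi> v) \<subseteq> interior K"
      by (intro in_interior_closure_convex_segment K wK)
    moreover have "v \<in> open_segment w (\<pi> v)"
    proof -
      have "w \<noteq> \<pi> v" using ap aw by auto
      moreover have "v = (1 - 1/l) *\<^sub>R w + (1/l) *\<^sub>R \<pi> v"
        using l by (simp add: \<pi>_def flip: l_def) (simp add: algebra_simps)
      ultimately show ?thesis using l unfolding in_segment by (intro conjI exI [of _ "1/l"]) auto
    qed
    ultimately show False using v(3) by (auto simp: frontier_def)
  qed
  ultimately have "U \<inter> ?C = {} \<or> V \<inter> ?C = {}"
    using connectedD [OF arc_connected] by blast
  moreover have "a \<bullet> y < a \<bullet> (z + s *\<^sub>R (z - y))"
  proof -
    have "a \<bullet> (z + s *\<^sub>R (z - y)) = a \<bullet> z + s * (a \<bullet> z - a \<bullet> y)" by (simp add: inner_simps)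
    moreover have "s * (a \<bullet> z - a \<bullet> y) \<ge> 0" using s(1) az by simp
    ultimately show ?thesis using az by linarith
  qed
  then have "V \<inter> ?C \<noteq> {}" using s(2) by (auto simp: V_def)
  moreover have "a \<bullet> (y + s' *\<^sub>R (y - z)) \<le> a \<bullet> y"
  proof -
    have "a \<bullet> (y + s' *\<^sub>R (y - z)) = a \<bullet> y - s' * (a \<bullet> z - a \<bullet> y)" by (simp add: inner_simps algebra_simps)
    moreover have "s' * (a \<bullet> z - a \<bullet> y) \<ge> 0" using s'(1) az by simp
    ultimately show ?thesis by linarith
  qed
  then have "y + s' *\<^sub>R (y - z) \<notin> V" by (simp add: V_def)
  then have "U \<inter> ?C \<noteq> {}" using s'(2) cover by blast
  ultimately show False by blast
qed

end

subsection \<open>Comparison of the areas\<close>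

context convex_body_removed_disc
begin

lemma disc_meets_frontier_hull:
  assumes "F \<inter> convex hull X \<noteq> {}" "F \<inter> frontier K \<noteq> {}"
  shows "F \<inter> frontier (convex hull X) \<noteq> {}"
proof
  assume "F \<inter> frontier (convex hull X) = {}"
  then have "F \<subseteq> convex hull X"
    using connected_Int_frontier [of F "convex hull X"] F assms(1) convex_connected by blast
  then have "F \<subseteq> interior K"
    using F(1) hull_subset by (meson interior_maximal order_trans)
  then show False using assms(2) by (auto simp: frontier_def)
qed

text \<open>Cut \<open>F\<close> along the supporting line at a point \<open>c\<close> of the
  frontier of the hull. No frontier point of the hull lies in \<open>F\<close> above this line, so
  \<open>U\<close>, the upper part of \<open>F\<close>, is inside the hull, and the rest of
  \<open>F\<close> within the hull lies on the line.\<close>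

lemma missed_part_decreasing:
  assumes "F \<inter> convex hull X \<noteq> {}" "F \<inter> frontier K \<noteq> {}" "bounded F"
    and frontier_disc: "frontier F \<inter> K \<subseteq> X"
  obtains U n b where "n \<noteq> 0" "U \<subseteq> F" "U \<subseteq> convex hull X"
    "F \<inter> convex hull X \<subseteq> U \<union> {x. n \<bullet> x = b}"
    "\<And>m. {z \<in> U. real m *\<^sub>R z \<notin> minkowski_multiple X m} \<in> lmeasurable"
    "\<And>m. m > 0 \<Longrightarrow> measure lebesgue {z \<in> U. real (Suc m) *\<^sub>R z \<notin> minkowski_multiple X (Suc m)}
      \<le> measure lebesgue {z \<in> U. real m *\<^sub>R z \<notin> minkowski_multiple X m}"
proof -
  let ?W = "convex hull X"
  obtain c where c: "c \<in> F" "c \<in> frontier ?W"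
    using disc_meets_frontier_hull assms by blast
  have cW: "c \<in> ?W" using c frontier_hull_subset by blast
  obtain n where n: "n \<noteq> 0" "\<And>x. x \<in> ?W \<Longrightarrow> n \<bullet> c \<le> n \<bullet> x"
    using supporting_hyperplane_frontier [OF convex_convex_hull hull_interior c(2) cW] by metis
  obtain d where d: "d \<noteq> 0" "n \<bullet> d = 0" using orthogonal_direction_real2 [OF n(1)] by metis
  interpret C: cut_convex_domain F c d n
    by unfold_locales (use F assms c d in auto)
  obtain w where w: "w \<in> F" "w \<in> interior ?W"
  proof -
    have "c \<in> closure (interior ?W)"
      using cW closure_subset [of ?W] by (simp add: convex_closure_interior hull_interior subset_eq)
    then have "F \<inter> interior ?W \<noteq> {}"
      using c(1) F(1) open_Int_closure_eq_empty by blast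
    then show ?thesis using that by blast
  qed
  have wU: "w \<in> C.upper"
    using w supporting_strict_interior [OF n w(2)] by (simp add: C.upper_def)
  have "C.upper = F \<inter> {x. n \<bullet> c < n \<bullet> x}" by (auto simp: C.upper_def)
  then have "connected C.upper"
    using F by (simp add: convex_connected convex_Int convex_halfspace_gt)
  moreover have "C.upper \<inter> frontier ?W = {}"
    using frontier_hull_in_line [OF c _ _ n] by (fastforce simp: C.upper_def)
  moreover have "C.upper \<inter> ?W \<noteq> {}"
    using w wU interior_subset by blast
  ultimately have upW: "C.upper \<subseteq> ?W"
    using connected_Int_frontier [of C.upper ?W] by blast
  have clW: "closed ?W" using X by (simp add: compact_convex_hull compact_imp_closed)
  have "C.upper_frontier \<subseteq> ?W"
  proof
    fix x assume x: "x \<in> C.upper_frontier"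
    \<comment> \<open>Moving \<open>x\<close> towards \<open>w\<close> enters \<open>upper\<close>;
      the limit at \<open>e = 0\<close> stays in the closed hull.\<close>
    let ?f = "\<lambda>e. e *\<^sub>R w + (1 - e) *\<^sub>R x"
    have "?f ` {0<..<1} \<subseteq> ?W"
    proof (rule order_trans [OF _ upW], clarsimp)
      fix e :: real assume e: "0 < e" "e < 1"
      have "?f e \<in> F"
        using e x C.upper_frontier_closure w F by (intro convex_shrink_into_open) auto
      moreover have "n \<bullet> c < n \<bullet> ?f e"
      proof -
        have "n \<bullet> ?f e - n \<bullet> c = e * (n \<bullet> w - n \<bullet> c) + (1 - e) * (n \<bullet> x - n \<bullet> c)"
          by (simp add: inner_simps algebra_simps)
        also have "\<dots> > 0"
          using e x wU by (intro add_pos_nonneg) (auto simp: C.upper_def C.upper_frontier_def)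
        finally show ?thesis by simp
      qed
      ultimately show "?f e \<in> C.upper" by (simp add: C.upper_def)
    qed
    then have "?f ` closure {0<..<1} \<subseteq> ?W"
      using clW by (intro image_closure_subset continuous_intros)
    then have "?f 0 \<in> ?W" by (rule subsetD) (rule imageI, simp)
    then show "x \<in> ?W" by simp
  qed
  then have "C.upper_frontier \<subseteq> X"
    using frontier_disc hull_subset by (auto simp: C.upper_frontier_def)
  then interpret C: cut_convex_domain_in F c d n X
    by unfold_locales (use X in auto)
  show ?thesis
  proof (rule that [of n C.upper "n \<bullet> c"])
    show "F \<inter> ?W \<subseteq> C.upper \<union> {x. n \<bullet> x = n \<bullet> c}"
      using n(2) by (force simp: C.upper_def)
    show "{z \<in> C.upper. real m *\<^sub>R z \<notin> minkowski_multiple X m} \<in> lmeasurable" for m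
      using C.missed_lmeasurable by (simp add: C.missed_def)
    show "measure lebesgue {z \<in> C.upper. real (Suc m) *\<^sub>R z \<notin> minkowski_multiple X (Suc m)}
      \<le> measure lebesgue {z \<in> C.upper. real m *\<^sub>R z \<notin> minkowski_multiple X m}" if "m > 0" for m
      using C.measure_missed_Suc_le [OF that] by (simp only: C.missed_def)
  qed (use n upW in \<open>auto simp: C.upper_def\<close>)
qed

end

section \<open>Families of disjoint open sets\<close>

lemma connected_subset_disjoint_open_family:
  assumes "connected S" "S \<subseteq> (\<Union>j\<in>I. F j)" "\<And>j. j \<in> I \<Longrightarrow> open (F j)" "disjoint_family_on F I"
    and "i \<in> I" "S \<inter> F i \<noteq> {}"
  shows "S \<subseteq> F i"
proof -
  have "open (F i)" "open (\<Union>j\<in>I - {i}. F j)" using assms by auto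
  moreover have "F i \<inter> (\<Union>j\<in>I - {i}. F j) \<inter> S = {}"
    using assms(4,5) by (fastforce simp: disjoint_family_on_def)
  moreover have "S \<subseteq> F i \<union> (\<Union>j\<in>I - {i}. F j)" using assms(2) by blast
  ultimately have "(\<Union>j\<in>I - {i}. F j) \<inter> S = {}"
    using connectedD [OF assms(1), of "F i" "\<Union>j\<in>I - {i}. F j"] assms(6) by blast
  then show ?thesis using assms(2) by blast
qed

lemma frontier_disjoint_open_family:
  assumes "\<And>j. j \<in> I \<Longrightarrow> open (F j)" "disjoint_family_on F I" "i \<in> I" "j \<in> I"
  shows "frontier (F i) \<inter> F j = {}"
proof (cases "i = j")
  case True
  then show ?thesis using assms by (simp add: frontier_disjoint_eq)
next
  case False
  then have "F j \<inter> closure (F i) = {}"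
    using assms by (metis disjoint_family_onD open_Int_closure_eq_empty)
  then show ?thesis by (auto simp: frontier_def)
qed

lemma countable_disjoint_open_family:
  fixes F :: "'i \<Rightarrow> 'a::second_countable_topology set"
  assumes "\<And>j. j \<in> I \<Longrightarrow> open (F j)" "\<And>j. j \<in> I \<Longrightarrow> F j \<noteq> {}" "disjoint_family_on F I"
  shows "countable I"
proof (rule countable_image_inj_on)
  show "countable (F ` I)"
    using assms(1) disjoint_family_on_disjoint_image [OF assms(3)]
    by (intro countable_disjoint_open_subsets) (auto simp: disjoint_def pairwise_def disjnt_def)
  show "inj_on F I"
  proof (rule inj_onI, rule ccontr)
    fix i j assume ij: "i \<in> I" "j \<in> I" "F i = F j" "i \<noteq> j"
    then have "F i \<inter> F j = {}" by (intro disjoint_family_onD [OF assms(3)])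
    then show False using ij assms(2) by auto
  qed
qed

lemma scaled_minkowski_multiple_eq:
  fixes X :: "'a::real_vector set"
  assumes "m > 0"
  shows "(*\<^sub>R) (1 / real m) ` minkowski_multiple X m = {z. real m *\<^sub>R z \<in> minkowski_multiple X m}"
proof safe
  fix z assume "real m *\<^sub>R z \<in> minkowski_multiple X m"
  then show "z \<in> (*\<^sub>R) (1 / real m) ` minkowski_multiple X m"
    using assms by (intro image_eqI [of _ _ "real m *\<^sub>R z"]) auto
qed (use assms in simp)

theorem theorem2:
  fixes k :: nat and K X :: "(real^2) set" and I :: "'i set" and F :: "'i \<Rightarrow> (real^2) set"
  assumes "k \<ge> 2"
    and "convex_body K"
    and "\<And>i. i \<in> I \<Longrightarrow> open_topological_disc (F i)"
    and "disjoint_family_on F I"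
    and "\<And>i. i \<in> I \<Longrightarrow> F i \<inter> frontier K \<noteq> {} \<Longrightarrow>
           connected (F i \<inter> frontier K) \<and> convex (F i)"
    and "X = K - (\<Union>i\<in>I. F i)"
  shows "measure lebesgue ((*\<^sub>R) (1 / real k) ` minkowski_multiple X k)
       \<le> measure lebesgue ((*\<^sub>R) (1 / real (k + 1)) ` minkowski_multiple X (k + 1))"
proof -
  let ?W = "convex hull X"
  \<comment> \<open>This equals \<open>X[m] / m\<close> for \<open>m > 0\<close>, whereas
    \<open>A 0\<close> is the whole plane.\<close>
  define A where "A m = {z. real m *\<^sub>R z \<in> minkowski_multiple X m}" for m
  have K: "compact K" "convex K" using assms(2) by (auto simp: convex_body_def)
  note disc = open_topological_disc_properties [OF assms(3)]
  have X: "compact X" "X \<subseteq> K"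
    unfolding assms(6) using K disc by (auto intro!: compact_diff)
  have WK: "?W \<subseteq> K" using X K by (simp add: hull_minimal)
  have AW: "A m \<subseteq> ?W" if "m > 0" for m
    using scaled_minkowski_multiple_subset_hull [OF that] by (auto simp: A_def)
  have cpt: "compact (A m)" if "m > 0" for m
    unfolding A_def scaled_minkowski_multiple_eq [OF that, symmetric]
    by (intro compact_scaling compact_minkowski_multiple X)
  have frX: "frontier (F i) \<inter> K \<subseteq> X" if "i \<in> I" for i
    unfolding assms(6) using frontier_disjoint_open_family [OF disc(1) assms(4) that] by blast
  have "measure lebesgue (A k) \<le> measure lebesgue (A (Suc k))"
  proof (cases "interior ?W = {}")
    case True
    then have "negligible ?W" by (simp add: negligible_convex_interior)
    then have "negligible (A k)" using AW [of k] assms(1) negligible_subset by simp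
    then show ?thesis by (simp add: negligible_imp_measure0)
  next
    case False
    define B where "B = {i \<in> I. F i \<inter> frontier K \<noteq> {} \<and> F i \<inter> ?W \<noteq> {}}"
    define Q where "Q i U n b \<longleftrightarrow> n \<noteq> 0 \<and> U \<subseteq> F i \<and> U \<subseteq> ?W \<and> F i \<inter> ?W \<subseteq> U \<union> {x. n \<bullet> x = b} \<and>
        (\<forall>m. U - A m \<in> lmeasurable) \<and>
        (\<forall>m>0. measure lebesgue (U - A (Suc m)) \<le> measure lebesgue (U - A m))" for i U n b
    have "\<exists>U n b. Q i U n b" if "i \<in> B" for i
    proof -
      have i: "i \<in> I" "F i \<inter> frontier K \<noteq> {}" "F i \<inter> ?W \<noteq> {}" using that by (auto simp: B_def)
      interpret convex_body_removed_disc K X "F i"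
      proof
        show "F i \<inter> X = {}" using i assms(6) by blast
        fix S :: "(real^2) set" assume "connected S" "S \<subseteq> K - X" "S \<inter> F i \<noteq> {}"
        then show "S \<subseteq> F i"
          using connected_subset_disjoint_open_family [OF _ _ disc(1) assms(4) i(1)] assms(6) by blast
      qed (use K X False disc i assms(5) in auto)
      have eq: "{z \<in> U. real m *\<^sub>R z \<notin> minkowski_multiple X m} = U - A m" for U m
        by (auto simp: A_def)
      obtain U n b where "n \<noteq> 0" "U \<subseteq> F i" "U \<subseteq> ?W" "F i \<inter> ?W \<subseteq> U \<union> {x. n \<bullet> x = b}"
        "\<And>m. U - A m \<in> lmeasurable"
        "\<And>m. m > 0 \<Longrightarrow> measure lebesgue (U - A (Suc m)) \<le> measure lebesgue (U - A m)"
        by (rule missed_part_decreasing [OF i(3,2) disc(2) [OF i(1)] frX [OF i(1)], unfolded eq]) (rule that)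
      then have "Q i U n b" by (simp add: Q_def)
      then show ?thesis by blast
    qed
    then have "\<forall>i\<in>B. \<exists>p. Q i (fst p) (fst (snd p)) (snd (snd p))"
      by simp
    from bchoice [OF this] obtain f where f: "\<forall>i\<in>B. Q i (fst (f i)) (fst (snd (f i))) (snd (snd (f i)))" ..
    define U n b where "U i = fst (f i)" "n i = fst (snd (f i))" "b i = snd (snd (f i))" for i
    have U: "n i \<noteq> 0" "U i \<subseteq> F i" "U i \<subseteq> ?W" "F i \<inter> ?W \<subseteq> U i \<union> {x. n i \<bullet> x = b i}"
        "U i - A m \<in> lmeasurable" if "i \<in> B" for i m
      using f that by (auto simp: Q_def U_n_b_def)
    have U_le: "measure lebesgue (U i - A (Suc m)) \<le> measure lebesgue (U i - A m)" if "i \<in> B" "m > 0" for i m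
      using f that by (auto simp: Q_def U_n_b_def)
    \<comment> \<open>The cutting lines are countably many, so they form a null set.\<close>
    define H where "H = (\<Union>i\<in>B. {x. n i \<bullet> x = b i})"
    define G where "G m = (\<Union>i\<in>B. U i - A m)" for m
    have "countable I" using countable_disjoint_open_family [OF disc(1,4) assms(4)] by blast
    then have B: "countable B" "B \<subseteq> I" by (auto simp: B_def intro: countable_subset)
    have "negligible H"
      unfolding H_def using B U by (intro negligible_countable_Union) (auto intro: negligible_hyperplane)
    then have H: "H \<in> null_sets lebesgue" by (simp add: negligible_iff_null_sets)
    have UA: "U i - A m \<in> sets lebesgue" if "i \<in> B" for i m
      using U(5) that by (auto intro: fmeasurableD)
    have G: "G m \<in> sets lebesgue" for m
      unfolding G_def using B UA by (intro sets.countable_UN'') auto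
    have disj: "disjoint_family_on (\<lambda>i. U i - A m) B" for m
      using disjoint_family_on_mono [OF B(2) assms(4)] U(2) unfolding disjoint_family_on_def by blast
    \<comment> \<open>A disc that avoids \<open>frontier K\<close> but contains a point of the hull
      lies in \<open>K\<close> and has its frontier in \<open>X\<close>, so with two or more
      summands none of its points is missed.\<close>
    have cover: "?W - A m \<subseteq> G m \<union> H" if "m \<ge> 2" for m
    proof
      fix z assume z: "z \<in> ?W - A m"
      have "z \<notin> X"
        using z scaleR_mem_minkowski_multiple [of z X m] by (auto simp: A_def)
      then obtain i where i: "i \<in> I" "z \<in> F i" using z WK assms(6) by blast
      have "F i \<inter> frontier K \<noteq> {}"
      proof
        assume "F i \<inter> frontier K = {}"
        then have "F i \<subseteq> K"
          using connected_Int_frontier [of "F i" K] disc(3) i z WK by blast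
        then have "closure (F i) \<subseteq> K" using K by (simp add: closure_minimal compact_imp_closed)
        then have "frontier (F i) \<subseteq> X" using frX [OF i(1)] by (auto simp: frontier_def)
        moreover have "real m *\<^sub>R z \<in> minkowski_multiple (frontier (F i)) m"
          using disc i that by (intro disc_in_minkowski_frontier) auto
        ultimately show False
          using z minkowski_multiple_mono [of "frontier (F i)" X m] by (auto simp: A_def)
      qed
      then have "i \<in> B" using i z by (auto simp: B_def)
      then show "z \<in> G m \<union> H" using U(4) i z unfolding G_def H_def by blast
    qed
    \<comment> \<open>With extended nonnegative measures the comparison disc by disc can be summed
      over an infinite \<open>B\<close> without summability conditions.\<close>
    have "emeasure lebesgue (?W - A (Suc k)) \<le> emeasure lebesgue (G (Suc k) \<union> H)"
      using cover [of "Suc k"] assms(1) G H by (intro emeasure_mono) auto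
    also have "\<dots> = emeasure lebesgue (G (Suc k))"
      using G H by (rule emeasure_Un_null_set)
    also have "\<dots> = (\<integral>\<^sup>+i. emeasure lebesgue (U i - A (Suc k)) \<partial>count_space B)"
      unfolding G_def using UA B disj by (intro emeasure_UN_countable) auto
    also have "\<dots> \<le> (\<integral>\<^sup>+i. emeasure lebesgue (U i - A k) \<partial>count_space B)"
      using U(5) U_le [of _ k] assms(1) by (intro nn_integral_mono) (simp add: emeasure_eq_measure2)
    also have "\<dots> = emeasure lebesgue (G k)"
      unfolding G_def using UA B disj by (intro emeasure_UN_countable [symmetric]) auto
    also have "\<dots> \<le> emeasure lebesgue (?W - A k)"
    proof (rule emeasure_mono)
      show "G k \<subseteq> ?W - A k" using U(3) unfolding G_def by blast
      show "?W - A k \<in> sets lebesgue"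
        using X cpt [of k] assms(1) by (intro sets.Diff) (auto intro!: fmeasurableD lmeasurable_compact compact_convex_hull)
    qed
    finally have le: "emeasure lebesgue (?W - A (Suc k)) \<le> emeasure lebesgue (?W - A k)" .
    have W: "?W \<in> lmeasurable" using X by (simp add: lmeasurable_compact compact_convex_hull)
    have Am: "A m \<in> lmeasurable" if "m > 0" for m using cpt [OF that] lmeasurable_compact by blast
    have "measure lebesgue (?W - A (Suc k)) \<le> measure lebesgue (?W - A k)"
      using le W Am [of k] Am [of "Suc k"] assms(1)
      by (simp add: emeasure_eq_measure2 fmeasurable.Diff)
    moreover have "measure lebesgue (?W - A m) = measure lebesgue ?W - measure lebesgue (A m)" if "m > 0" for m
      using W Am [OF that] AW [OF that] by (intro measurable_measure_Diff) (auto simp: fmeasurableD)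
    ultimately show ?thesis using assms(1) by simp
  qed
  then show ?thesis
    using assms(1) by (simp add: A_def scaled_minkowski_multiple_eq del: of_nat_Suc)
qed

end
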